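(* Let $r\in(0,\infty)$ be fixed and $v=1/(1+1/r)$. Consider the Spike-and-Slab prior on $\mathbb{R}^n$ with Dirac spike and Laplace slab, $$\pi(\theta\mid\lambda,\eta)=\prod_{i=1}^n\left[\eta\,\tfrac{\lambda}{2}e^{-\lambda|\theta_i|}+(1-\eta)\,\delta_0(\theta_i)\right],$$ with $\eta\in(0,1)$ determined by $(1-\eta)/\eta=n/s_n$. Choose $\lambda>0$ as follows: if $0<r<1$, $\lambda^2=vC_r$ for a constant $C_r>2/[v(1/2+4)]$; if $r\ge1$, $\lambda^2=(1-v)C_r^*$ for a constant $C_r^*>2/[5(1-v)]$. Let $\hat p$ be the corresponding Bayesian predictive density. If $s_n/n\to0$ as $n\to\infty$, then for all sufficiently large $n$ $$\sup_{\theta\in\Theta_n(s_n)}\rho_n(\theta,\hat p)\le\frac{5}{1+r}\,s_n\log(n/s_n)+\tilde C(r),$$ where for $r\ge1$ $$\tilde C(r)=\log(8\sqrt\pi)+10+2C_r^*(1-v)+C_r^*\sqrt{2/\pi}+\log\left(2\sqrt{C_r^*(1-v)}+C_r^*(1-v)\right),$$ and for $0<r<1$ $$\tilde C(r)=\log(8\sqrt{2\pi})+9+\frac{C_r}{r+1}(1/2+4)+\sqrt{C_r}\sqrt{1/(8\pi)}+\log\left(2\sqrt{C_r}+C_r\right).$$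
   Context: Given $\theta\in\mathbb{R}^n$, $Y\sim N_n(\theta,I)$ is observed and the independent $\tilde Y\sim N_n(\theta,rI)$ is to be predicted, $r$ known; $\pi(Y\mid\theta)$, $\pi(\tilde Y\mid\theta)$ denote these densities. $\Theta_n(s_n)=\{\theta\in\mathbb{R}^n:\|\theta\|_0\le s_n\}$, where $\|\theta\|_0$ is the number of nonzero coordinates and $1\le s_n\le n$ is an integer. $\delta_0$ is the point mass at zero. For a prior $\pi$ on $\mathbb{R}^n$ the Bayesian predictive density is $\hat p(\tilde Y\mid Y)=\int\pi(\tilde Y\mid\theta)\,\pi(d\theta\mid Y)$, where $\pi(d\theta\mid Y)$ is the posterior. The risk is $$\rho_n(\theta,\hat p)=\int\pi(Y\mid\theta)\int\pi(\tilde Y\mid\theta)\log\frac{\pi(\tilde Y\mid\theta)}{\hat p(\tilde Y\mid Y)}\,d\tilde Y\,dY.$$ *)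

theory Defs
  imports "HOL-Probability.Probability"
begin

(* Points of R^n are the functions in {..<n} \<rightarrow>\<^sub>E UNIV, i.e. coordinates are indexed by
   0, ..., n - 1 and the function is undefined elsewhere; this is the space of the
   n-fold product measures below. *)

definition lebesgue_prod :: "nat \<Rightarrow> (nat \<Rightarrow> real) measure" where
  "lebesgue_prod n = (\<Pi>\<^sub>M i\<in>{..<n}. lborel)"

definition sparse_vectors :: "nat \<Rightarrow> nat \<Rightarrow> (nat \<Rightarrow> real) set" where
  "sparse_vectors n s = {\<theta> \<in> {..<n} \<rightarrow>\<^sub>E UNIV. card {i \<in> {..<n}. \<theta> i \<noteq> 0} \<le> s}"

(* Lebesgue density of N_n(\<theta>, w I). The library's normal_density takes the standard
   deviation, not the variance. *)

definition gauss_density :: "nat \<Rightarrow> real \<Rightarrow> (nat \<Rightarrow> real) \<Rightarrow> (nat \<Rightarrow> real) \<Rightarrow> real" where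
  "gauss_density n w \<theta> y = (\<Prod>i<n. normal_density (\<theta> i) (sqrt w) (y i))"

definition laplace_density :: "real \<Rightarrow> real \<Rightarrow> real" where
  "laplace_density l x = l / 2 * exp (- l * \<bar>x\<bar>)"

definition spike_slab1 :: "real \<Rightarrow> real \<Rightarrow> real measure" where
  "spike_slab1 l \<eta> = measure_of UNIV (sets borel)
     (\<lambda>A. ennreal \<eta> * emeasure (density lborel (\<lambda>x. ennreal (laplace_density l x))) A
        + ennreal (1 - \<eta>) * emeasure (return borel 0) A)"

definition spike_slab :: "nat \<Rightarrow> real \<Rightarrow> real \<Rightarrow> (nat \<Rightarrow> real) measure" where
  "spike_slab n l \<eta> = (\<Pi>\<^sub>M i\<in>{..<n}. spike_slab1 l \<eta>)"

definition posterior :: "nat \<Rightarrow> (nat \<Rightarrow> real) measure \<Rightarrow> (nat \<Rightarrow> real) \<Rightarrow> (nat \<Rightarrow> real) measure" where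
  "posterior n P y =
     density P (\<lambda>\<theta>. ennreal (gauss_density n 1 \<theta> y / (\<integral>\<theta>'. gauss_density n 1 \<theta>' y \<partial>P)))"

(* For a prior probability measure P on R^n the Bochner integrals here and in the
   posterior are genuine: the Gaussian densities are strictly positive and bounded. *)

definition pred_density ::
    "nat \<Rightarrow> real \<Rightarrow> (nat \<Rightarrow> real) measure \<Rightarrow> (nat \<Rightarrow> real) \<Rightarrow> (nat \<Rightarrow> real) \<Rightarrow> real" where
  "pred_density n r P y y' = (\<integral>\<theta>. gauss_density n r \<theta> y' \<partial>posterior n P y)"

(* Lebesgue integral with values in [-\<infinity>, \<infinity>]: unlike the Bochner integral it does not
   default to 0 when the integral diverges. The indeterminate \<infinity> - \<infinity> equals \<infinity> in ereal,
   so it cannot help an upper bound. *)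

definition ext_integral :: "'a measure \<Rightarrow> ('a \<Rightarrow> ereal) \<Rightarrow> ereal" where
  "ext_integral M f =
     enn2ereal (\<integral>\<^sup>+x. e2ennreal (f x) \<partial>M) - enn2ereal (\<integral>\<^sup>+x. e2ennreal (- f x) \<partial>M)"

definition pred_risk ::
    "nat \<Rightarrow> real \<Rightarrow> (nat \<Rightarrow> real) \<Rightarrow> ((nat \<Rightarrow> real) \<Rightarrow> (nat \<Rightarrow> real) \<Rightarrow> real) \<Rightarrow> ereal" where
  "pred_risk n r \<theta> p =
     ext_integral (lebesgue_prod n) (\<lambda>y. ereal (gauss_density n 1 \<theta> y) *
       ext_integral (lebesgue_prod n) (\<lambda>y'.
         ereal (gauss_density n r \<theta> y' * ln (gauss_density n r \<theta> y' / p y y'))))"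

lemma ext_integral_eq_integral:
  assumes "integrable M f"
  shows "ext_integral M (\<lambda>x. ereal (f x)) = ereal (\<integral>x. f x \<partial>M)"
proof -
  have a: "(\<integral>\<^sup>+x. ennreal (f x) \<partial>M) < \<infinity>" "(\<integral>\<^sup>+x. ennreal (- f x) \<partial>M) < \<infinity>"
    using assms by (auto simp: real_integrable_def top.not_eq_extremum)
  have "ext_integral M (\<lambda>x. ereal (f x)) =
     enn2ereal (\<integral>\<^sup>+x. ennreal (f x) \<partial>M) - enn2ereal (\<integral>\<^sup>+x. ennreal (- f x) \<partial>M)"
    by (simp add: ext_integral_def e2ennreal_ereal)
  also have "\<dots> = ereal (enn2real (\<integral>\<^sup>+x. ennreal (f x) \<partial>M) - enn2real (\<integral>\<^sup>+x. ennreal (- f x) \<partial>M))"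
    using a by (cases "\<integral>\<^sup>+x. ennreal (f x) \<partial>M"; cases "\<integral>\<^sup>+x. ennreal (- f x) \<partial>M")
      (auto simp: enn2ereal_ennreal)
  also have "\<dots> = ereal (\<integral>x. f x \<partial>M)"
    using assms by (simp add: real_lebesgue_integral_def)
  finally show ?thesis .
qed

lemma sets_spike_slab1: "sets (spike_slab1 l \<eta>) = sets borel"
  unfolding spike_slab1_def
  by (metis sets.sigma_sets_eq sets_measure_of space_borel subset_UNIV Pow_UNIV)

lemma emeasure_spike_slab1:
  assumes "A \<in> sets borel"
  shows "emeasure (spike_slab1 l \<eta>) A =
    ennreal \<eta> * emeasure (density lborel (\<lambda>x. ennreal (laplace_density l x))) A
      + ennreal (1 - \<eta>) * emeasure (return borel 0) A"
proof (rule emeasure_measure_of[OF spike_slab1_def])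
  let ?D = "density lborel (\<lambda>x. ennreal (laplace_density l x))"
  let ?m = "\<lambda>A. ennreal \<eta> * emeasure ?D A + ennreal (1 - \<eta>) * emeasure (return borel 0) A"
  show "countably_additive (sets (spike_slab1 l \<eta>)) ?m"
  proof (rule countably_additiveI)
    fix F :: "nat \<Rightarrow> real set"
    assume F: "range F \<subseteq> sets (spike_slab1 l \<eta>)" "disjoint_family F"
    then have F': "range F \<subseteq> sets ?D" "range F \<subseteq> sets (return borel (0::real))"
      by (auto simp: sets_spike_slab1)
    show "(\<Sum>i. ?m (F i)) = ?m (\<Union>i. F i)"
      using F'[THEN suminf_emeasure] F(2)
      by (simp add: suminf_add[symmetric])
  qed
qed (use assms in \<open>auto simp: sets_spike_slab1 positive_def\<close>)

end

theory Submission
  imports Defs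
begin

text \<open>
  Likelihood, prior and reference density are products over the coordinates, so the risk is a sum
  of one-dimensional risks (\<open>pred_risk_eq_sum\<close>). In one coordinate, divide the averaged
  likelihood of the data by the likelihood at the true mean \<open>\<theta>\<close>. The risk is the expected
  logarithm of this ratio for the observation alone, minus the expected logarithm for the observation
  and the future observation together (\<open>coord_loss_eq\<close>). The total precisions are
  \<open>1\<close> and \<open>c = 1 + 1 / r = 1 / v\<close>.

  At \<open>\<theta> = 0\<close> the first expectation is nonpositive, and the spike bounds the second from
  below, so a zero coordinate costs at most \<open>- ln (1 - \<eta>) \<le> s / n\<close>
  (\<open>coord_risk_zero_le\<close>); all of them together cost at most \<open>s\<close>.

  For other means put \<open>L = - ln \<eta>\<close>. The ratio is, up to bounded factors and noise, the larger
  of a spike term \<open>exp (- c * \<theta>\<^sup>2 / 2)\<close> and a slab term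
  \<open>exp (- L - l * \<bar>\<theta>\<bar>)\<close>, with \<open>c = 1\<close> for the observation alone. If
  \<open>\<theta>\<^sup>2 / 4 \<ge> L + l * \<bar>\<theta>\<bar>\<close>, the slab term dominates in both ratios,
  the unbounded contributions cancel and the risk is bounded
  (\<open>spike_slab_coord_risk_large\<close>). Otherwise \<open>\<bar>\<theta>\<bar>\<close> is
  \<open>O(sqrt L)\<close> as \<open>L\<close> grows, and the risk is at most
  \<open>min (c * \<theta>\<^sup>2 / 2) L - min (\<theta>\<^sup>2 / 2) L + O(1 + \<bar>\<theta>\<bar>)\<close>.
  The difference of minima never exceeds \<open>(1 - 1 / c) * L = L / (1 + r)\<close>
  (\<open>min_scaled_diff_le\<close>), and the error is absorbed by another \<open>L / (1 + r)\<close>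
  plus a constant (\<open>spike_slab_coord_risk_moderate\<close>).

  The supremum of the risk is therefore at most \<open>s * (K + 2 / (1 + r) * ln (n / s))\<close> with
  \<open>K\<close> depending only on \<open>r\<close> and the slab scale. Because \<open>s \<ge> 1\<close> and
  \<open>ln (n / s)\<close> tends to infinity, the gap between the leading constants \<open>2 / (1 + r)\<close>
  and \<open>5 / (1 + r)\<close> eventually outweighs \<open>s * K\<close> and any additive constant
  (\<open>eventually_spike_slab_sup_risk_le\<close>).
\<close>

section \<open>Gaussian integrals\<close>

lemma has_bochner_integral_normal_quadratic:
  assumes "0 < \<sigma>"
  shows "has_bochner_integral lborel
    (\<lambda>x. normal_density \<mu> \<sigma> x * (a + b * (x - \<mu>) + d * (x - \<mu>)\<^sup>2)) (a + d * \<sigma>\<^sup>2)"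
proof -
  have 0: "has_bochner_integral lborel (\<lambda>x. normal_density \<mu> \<sigma> x) 1"
    using normal_moment_even[OF assms, of \<mu> 0] by simp
  have 1: "has_bochner_integral lborel (\<lambda>x. normal_density \<mu> \<sigma> x * (x - \<mu>)) 0"
    using normal_moment_odd[OF assms, of \<mu> 0] by simp
  have 2: "has_bochner_integral lborel (\<lambda>x. normal_density \<mu> \<sigma> x * (x - \<mu>)\<^sup>2) (\<sigma>\<^sup>2)"
    using normal_moment_even[OF assms, of \<mu> 1] assms by (simp add: fact_2)
  from has_bochner_integral_add[OF has_bochner_integral_add[OF
      has_bochner_integral_mult_right[OF 0, of a] has_bochner_integral_mult_right[OF 1, of b]]
      has_bochner_integral_mult_right[OF 2, of d]]
  show ?thesis by (simp add: algebra_simps)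
qed

lemma integrable_normal_quadratic_bound:
  assumes "0 < \<sigma>" and [measurable]: "f \<in> borel_measurable borel"
    and le: "\<And>x. \<bar>f x\<bar> \<le> a + d * (x - \<mu>)\<^sup>2"
  shows "integrable lborel (\<lambda>x. normal_density \<mu> \<sigma> x * f x)"
proof (rule Bochner_Integration.integrable_bound)
  show "integrable lborel (\<lambda>x. normal_density \<mu> \<sigma> x * (a + 0 * (x - \<mu>) + d * (x - \<mu>)\<^sup>2))"
    using has_bochner_integral_normal_quadratic[OF assms(1)] by (rule integrable.intros)
  show "AE x in lborel. norm (normal_density \<mu> \<sigma> x * f x)
      \<le> norm (normal_density \<mu> \<sigma> x * (a + 0 * (x - \<mu>) + d * (x - \<mu>)\<^sup>2))"
  proof (rule AE_I2)
    fix x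
    have "\<bar>f x\<bar> \<le> \<bar>a + d * (x - \<mu>)\<^sup>2\<bar>" using le[of x] by linarith
    then show "norm (normal_density \<mu> \<sigma> x * f x)
      \<le> norm (normal_density \<mu> \<sigma> x * (a + 0 * (x - \<mu>) + d * (x - \<mu>)\<^sup>2))"
      by (simp add: abs_mult mult_left_mono)
  qed
qed simp

text \<open>Changing the mean of a Gaussian multiplies its density by an exponential; this is the
  source of every likelihood ratio below.\<close>

lemma normal_density_exp_tilt:
  assumes "0 < \<sigma>"
  shows "normal_density t \<sigma> y =
    normal_density \<theta> \<sigma> y * exp ((t - \<theta>) * (y - \<theta>) / \<sigma>\<^sup>2 - (t - \<theta>)\<^sup>2 / (2 * \<sigma>\<^sup>2))"
proof -
  have "- (y - t)\<^sup>2 / (2 * \<sigma>\<^sup>2) =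
      - (y - \<theta>)\<^sup>2 / (2 * \<sigma>\<^sup>2) + ((t - \<theta>) * (y - \<theta>) / \<sigma>\<^sup>2 - (t - \<theta>)\<^sup>2 / (2 * \<sigma>\<^sup>2))"
    using assms by (simp add: field_simps power2_eq_square)
  then show ?thesis
    by (simp only: normal_density_def exp_add mult.assoc)
qed

lemma has_bochner_integral_normal_half_tilt:
  "has_bochner_integral lborel
    (\<lambda>y. normal_density \<theta> 1 y * exp (- \<theta> * (y - \<theta>) / 2 - \<theta>\<^sup>2 / 8)) 1"
proof -
  have "normal_density (\<theta> / 2) 1 y = normal_density \<theta> 1 y * exp (- \<theta> * (y - \<theta>) / 2 - \<theta>\<^sup>2 / 8)" for y
  proof -
    have "(\<theta> / 2 - \<theta>)\<^sup>2 = \<theta>\<^sup>2 / 4" by (simp add: power2_eq_square field_simps)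
    then show ?thesis
      using normal_density_exp_tilt[of 1 "\<theta> / 2" y \<theta>] by simp
  qed
  then show ?thesis
    using normal_moment_even[of 1 "\<theta> / 2" 0] by simp
qed

lemma normal_density_le:
  assumes "0 < \<sigma>"
  shows "normal_density t \<sigma> y \<le> 1 / sqrt (2 * pi * \<sigma>\<^sup>2)"
  using mult_left_mono[of "exp (- (y - t)\<^sup>2 / (2 * \<sigma>\<^sup>2))" 1 "1 / sqrt (2 * pi * \<sigma>\<^sup>2)"]
  by (simp add: normal_density_def)

text \<open>Here the mean is the variable: a prior integrates the Gaussian density over its mean.\<close>

lemma borel_measurable_normal_density_mean [measurable (raw)]:
  assumes [measurable]: "f \<in> borel_measurable M" "g \<in> borel_measurable M"
  shows "(\<lambda>x. normal_density (f x) \<sigma> (g x)) \<in> borel_measurable M"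
  unfolding normal_density_def by measurable

section \<open>Separation into coordinates\<close>

text \<open>A function of one coordinate has the same expectation under a product density as under
  the corresponding factor, because all other factors integrate to one; sum over the coordinates.\<close>

lemma has_bochner_integral_prod_density_sum:
  fixes f g :: "nat \<Rightarrow> real \<Rightarrow> real"
  assumes g: "\<And>i. i < n \<Longrightarrow> integrable lborel (g i)" "\<And>i. i < n \<Longrightarrow> (\<integral>x. g i x \<partial>lborel) = 1"
    and f: "\<And>i. i < n \<Longrightarrow> integrable lborel (\<lambda>x. g i x * f i x)"
  shows "has_bochner_integral (lebesgue_prod n)
    (\<lambda>y. (\<Prod>i<n. g i (y i)) * (\<Sum>i<n. f i (y i))) (\<Sum>i<n. \<integral>x. g i x * f i x \<partial>lborel)"
proof -
  interpret product_sigma_finite "\<lambda>_::nat. lborel :: real measure" ..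
  have "has_bochner_integral (lebesgue_prod n)
    (\<lambda>y. (\<Prod>i<n. g i (y i)) * f k (y k)) (\<integral>x. g k x * f k x \<partial>lborel)" if k: "k < n" for k
  proof -
    define G where "G j x = g j x * (if j = k then f k x else 1)" for j x
    have G: "integrable lborel (G j)" if "j \<in> {..<n}" for j
      using that g f k by (cases "j = k") (auto simp: G_def[abs_def])
    have "(\<Prod>j<n. \<integral>x. G j x \<partial>lborel) = (\<Prod>j<n. if j = k then \<integral>x. g k x * f k x \<partial>lborel else 1)"
      by (intro prod.cong) (auto simp: G_def g)
    also have "\<dots> = (\<integral>x. g k x * f k x \<partial>lborel)" using k by (simp add: prod.delta)
    finally have I: "(\<Prod>j<n. \<integral>x. G j x \<partial>lborel) = (\<integral>x. g k x * f k x \<partial>lborel)" .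
    have P: "(\<Prod>j<n. G j (y j)) = (\<Prod>i<n. g i (y i)) * f k (y k)" for y
      using k by (simp add: G_def prod.distrib prod.delta)
    show ?thesis
      using product_integrable_prod[of "{..<n}" G] product_integral_prod[of "{..<n}" G] G
      unfolding lebesgue_prod_def has_bochner_integral_iff P I by simp
  qed
  then show ?thesis
    unfolding sum_distrib_left by (intro has_bochner_integral_sum) simp
qed

text \<open>The likelihood averaged over the prior, relative to the likelihood at the true mean
  \<open>\<theta>\<close>, for data of total precision \<open>c\<close> with precision-weighted noise
  \<open>w\<close>. For \<open>y\<close> alone, \<open>c = 1\<close> and \<open>w = y - \<theta>\<close>; for
  \<open>y\<close> together with the future observation \<open>y'\<close> of variance \<open>r\<close>,
  \<open>c = 1 + 1 / r\<close> and \<open>w = (y - \<theta>) + (y' - \<theta>) / r\<close>.\<close>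

definition likelihood_ratio :: "real measure \<Rightarrow> real \<Rightarrow> real \<Rightarrow> real \<Rightarrow> real" where
  "likelihood_ratio P \<theta> c w = (\<integral>t. exp ((t - \<theta>) * w - c * (t - \<theta>)\<^sup>2 / 2) \<partial>P)"

definition coord_pred_density :: "real measure \<Rightarrow> real \<Rightarrow> real \<Rightarrow> real \<Rightarrow> real" where
  "coord_pred_density P r y y' =
     (\<integral>t. normal_density t 1 y * normal_density t (sqrt r) y' \<partial>P) / (\<integral>t. normal_density t 1 y \<partial>P)"

definition coord_loss :: "real measure \<Rightarrow> real \<Rightarrow> real \<Rightarrow> real \<Rightarrow> real" where
  "coord_loss P r \<theta> y = (\<integral>y'. normal_density \<theta> (sqrt r) y' *
     ln (normal_density \<theta> (sqrt r) y' / coord_pred_density P r y y') \<partial>lborel)"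

definition coord_risk :: "real measure \<Rightarrow> real \<Rightarrow> real \<Rightarrow> real" where
  "coord_risk P r \<theta> = (\<integral>y. normal_density \<theta> 1 y * coord_loss P r \<theta> y \<partial>lborel)"

text \<open>Completing the square in \<open>x\<close>.\<close>

lemma tilt_exponent_le:
  fixes x w c :: real
  assumes "0 < c"
  shows "x * w - c * x\<^sup>2 / 2 \<le> w\<^sup>2 / (2 * c)"
proof -
  have "w\<^sup>2 / (2 * c) - (x * w - c * x\<^sup>2 / 2) = (w - c * x)\<^sup>2 / (2 * c)"
    using assms by (simp add: field_simps power2_eq_square)
  also have "\<dots> \<ge> 0" using assms by simp
  finally show ?thesis by simp
qed

section \<open>Priors on the line with an atom at zero\<close>

text \<open>The atom bounds the log likelihood ratio below by a linear function of the noise, and completing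
  the square bounds it above by a quadratic one, so all expectations below are finite.\<close>

locale spike_prior = prob_space P for P :: "real measure" +
  assumes sets_P [measurable_cong]: "sets P = sets borel"
    and atom: "0 < measure P {0}"
begin

lemma space_P: "space P = UNIV"
  using sets_eq_imp_space_eq[OF sets_P] by simp

lemma integrable_likelihood_ratio:
  assumes "0 < c"
  shows "integrable P (\<lambda>t. exp ((t - \<theta>) * w - c * (t - \<theta>)\<^sup>2 / 2))"
  by (rule integrable_const_bound[where B = "exp (w\<^sup>2 / (2 * c))"])
     (use tilt_exponent_le[OF assms] in auto)

lemma likelihood_ratio_le:
  assumes "0 < c"
  shows "likelihood_ratio P \<theta> c w \<le> exp (w\<^sup>2 / (2 * c))"
proof -
  have "likelihood_ratio P \<theta> c w \<le> (\<integral>t. exp (w\<^sup>2 / (2 * c)) \<partial>P)"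
    unfolding likelihood_ratio_def
    by (rule integral_mono) (use integrable_likelihood_ratio tilt_exponent_le assms in auto)
  then show ?thesis by (simp add: prob_space)
qed

lemma likelihood_ratio_ge_atom:
  assumes "0 < c"
  shows "measure P {0} * exp (- \<theta> * w - c * \<theta>\<^sup>2 / 2) \<le> likelihood_ratio P \<theta> c w"
proof -
  have "measure P {0} * exp (- \<theta> * w - c * \<theta>\<^sup>2 / 2) =
      (\<integral>t. indicator {0} t * exp (- \<theta> * w - c * \<theta>\<^sup>2 / 2) \<partial>P)"
    by (simp add: sets_P space_P)
  also have "\<dots> \<le> likelihood_ratio P \<theta> c w"
    unfolding likelihood_ratio_def
  proof (rule integral_mono)
    show "integrable P (\<lambda>t. indicator {0} t * exp (- \<theta> * w - c * \<theta>\<^sup>2 / 2))"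
      by (intro integrable_mult_left integrable_real_indicator) (auto simp: sets_P emeasure_eq_measure)
  qed (use integrable_likelihood_ratio[OF assms] in \<open>auto simp: indicator_def\<close>)
  finally show ?thesis .
qed

lemma likelihood_ratio_pos: "0 < c \<Longrightarrow> 0 < likelihood_ratio P \<theta> c w"
  using likelihood_ratio_ge_atom[of c \<theta> w] atom
  by (meson exp_gt_zero less_le_trans mult_pos_pos)

lemma ln_likelihood_ratio_ge:
  assumes "0 < c"
  shows "ln (measure P {0}) - \<theta> * w - c * \<theta>\<^sup>2 / 2 \<le> ln (likelihood_ratio P \<theta> c w)"
proof -
  have "ln (measure P {0} * exp (- \<theta> * w - c * \<theta>\<^sup>2 / 2)) \<le> ln (likelihood_ratio P \<theta> c w)"
    using likelihood_ratio_ge_atom[OF assms, of \<theta> w] atom likelihood_ratio_pos[OF assms, of \<theta> w]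
    by (subst ln_le_cancel_iff) auto
  then show ?thesis using atom by (simp add: ln_mult)
qed

lemma abs_ln_likelihood_ratio_le:
  assumes "0 < c"
  shows "\<bar>ln (likelihood_ratio P \<theta> c w)\<bar>
    \<le> (\<bar>ln (measure P {0})\<bar> + c * \<theta>\<^sup>2 / 2 + \<theta>\<^sup>2 / 2) + (1 / (2 * c) + 1 / 2) * w\<^sup>2"
proof -
  have "ln (likelihood_ratio P \<theta> c w) \<le> w\<^sup>2 / (2 * c)"
    using likelihood_ratio_le[OF assms, of \<theta> w] likelihood_ratio_pos[OF assms, of \<theta> w]
    by (metis ln_exp ln_mono)
  moreover have "- ln (likelihood_ratio P \<theta> c w) \<le> - ln (measure P {0}) + \<theta> * w + c * \<theta>\<^sup>2 / 2"
    using ln_likelihood_ratio_ge[OF assms, of \<theta> w] by simp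
  moreover have "\<theta> * w \<le> \<theta>\<^sup>2 / 2 + w\<^sup>2 / 2"
    using sum_squares_bound[of \<theta> w] by simp
  moreover have "w\<^sup>2 / (2 * c) \<ge> 0" "c * \<theta>\<^sup>2 \<ge> 0" "w\<^sup>2 \<ge> 0" "\<theta>\<^sup>2 \<ge> 0" using assms by auto
  moreover have "(1 / (2 * c) + 1 / 2) * w\<^sup>2 = w\<^sup>2 / (2 * c) + w\<^sup>2 / 2"
    by (simp add: algebra_simps)
  moreover have "- ln (measure P {0}) \<le> \<bar>ln (measure P {0})\<bar>" "0 \<le> \<bar>ln (measure P {0})\<bar>" by auto
  ultimately show ?thesis
    unfolding abs_le_iff by linarith
qed

lemma borel_measurable_likelihood_ratio [measurable (raw)]:
  assumes [measurable]: "f \<in> borel_measurable M"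
  shows "(\<lambda>x. likelihood_ratio P \<theta> c (f x)) \<in> borel_measurable M"
  unfolding likelihood_ratio_def by measurable

lemma integrable_normal_density_mean:
  "integrable P (\<lambda>t. normal_density t 1 y)"
  by (rule integrable_const_bound[where B = "1 / sqrt (2 * pi)"])
     (use normal_density_le[of 1] in simp_all)

lemma integrable_joint_normal_density_mean:
  assumes "0 < \<sigma>"
  shows "integrable P (\<lambda>t. normal_density t 1 y * normal_density t \<sigma> y')"
proof (rule integrable_const_bound)
  show "AE t in P. norm (normal_density t 1 y * normal_density t \<sigma> y')
      \<le> 1 / sqrt (2 * pi) * (1 / sqrt (2 * pi * \<sigma>\<^sup>2))"
    using mult_mono[OF normal_density_le[of 1 _ y] normal_density_le[OF assms]]
    by (simp add: abs_mult)
qed measurable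

lemma marginal_eq_likelihood_ratio:
  "(\<integral>t. normal_density t 1 y \<partial>P) = normal_density \<theta> 1 y * likelihood_ratio P \<theta> 1 (y - \<theta>)"
proof -
  have "normal_density t 1 y =
      normal_density \<theta> 1 y * exp ((t - \<theta>) * (y - \<theta>) - 1 * (t - \<theta>)\<^sup>2 / 2)" for t
    using normal_density_exp_tilt[of 1 t y \<theta>] by simp
  then show ?thesis
    unfolding likelihood_ratio_def integral_mult_right_zero[symmetric]
    by (intro Bochner_Integration.integral_cong refl)
qed

lemma joint_marginal_eq_likelihood_ratio:
  assumes r: "0 < r"
  shows "(\<integral>t. normal_density t 1 y * normal_density t (sqrt r) y' \<partial>P) =
    normal_density \<theta> 1 y * normal_density \<theta> (sqrt r) y' *
      likelihood_ratio P \<theta> (1 + 1 / r) ((y - \<theta>) + (y' - \<theta>) / r)"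
proof -
  have "normal_density t 1 y * normal_density t (sqrt r) y' =
      normal_density \<theta> 1 y * normal_density \<theta> (sqrt r) y' *
      exp ((t - \<theta>) * ((y - \<theta>) + (y' - \<theta>) / r) - (1 + 1 / r) * (t - \<theta>)\<^sup>2 / 2)" for t
  proof -
    have "(t - \<theta>) * ((y - \<theta>) + (y' - \<theta>) / r) - (1 + 1 / r) * (t - \<theta>)\<^sup>2 / 2 =
        ((t - \<theta>) * (y - \<theta>) / 1\<^sup>2 - (t - \<theta>)\<^sup>2 / (2 * 1\<^sup>2)) +
        ((t - \<theta>) * (y' - \<theta>) / (sqrt r)\<^sup>2 - (t - \<theta>)\<^sup>2 / (2 * (sqrt r)\<^sup>2))"
      using r by (simp add: distrib_left distrib_right add_divide_distrib)
    then show ?thesis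
      using normal_density_exp_tilt[of 1 t y \<theta>] normal_density_exp_tilt[of "sqrt r" t y' \<theta>] r
      by (simp only: exp_add) simp
  qed
  then show ?thesis
    unfolding likelihood_ratio_def integral_mult_right_zero[symmetric]
    by (intro Bochner_Integration.integral_cong refl)
qed

text \<open>Both factors of the predictive density are likelihood ratios up to the same Gaussian densities,
  which cancel. Hence the risk at \<open>\<theta>\<close> is the expected log likelihood ratio of the
  present observation minus that of the present and future observations together.\<close>

lemma ln_coord_ratio_eq:
  assumes r: "0 < r"
  shows "0 < coord_pred_density P r y y'"
    and "ln (normal_density \<theta> (sqrt r) y' / coord_pred_density P r y y') =
      ln (likelihood_ratio P \<theta> 1 (y - \<theta>))
        - ln (likelihood_ratio P \<theta> (1 + 1 / r) ((y - \<theta>) + (y' - \<theta>) / r))"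
proof -
  have c: "0 < 1 + 1 / r" using r by (simp add: add_pos_pos)
  have pos: "0 < normal_density \<theta> 1 y" "0 < normal_density \<theta> (sqrt r) y'"
    using r by (auto intro!: normal_density_pos)
  note lr = likelihood_ratio_pos[OF zero_less_one, of \<theta> "y - \<theta>"]
    likelihood_ratio_pos[OF c, of \<theta> "(y - \<theta>) + (y' - \<theta>) / r"]
  have eq: "coord_pred_density P r y y' = normal_density \<theta> (sqrt r) y' *
      (likelihood_ratio P \<theta> (1 + 1 / r) ((y - \<theta>) + (y' - \<theta>) / r) / likelihood_ratio P \<theta> 1 (y - \<theta>))"
    unfolding coord_pred_density_def marginal_eq_likelihood_ratio[of y \<theta>]
      joint_marginal_eq_likelihood_ratio[OF r, of y y' \<theta>]
    using pos lr by simp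
  show "0 < coord_pred_density P r y y'"
    unfolding eq using pos lr by (intro mult_pos_pos divide_pos_pos)
  have "normal_density \<theta> (sqrt r) y' / coord_pred_density P r y y' =
      likelihood_ratio P \<theta> 1 (y - \<theta>) / likelihood_ratio P \<theta> (1 + 1 / r) ((y - \<theta>) + (y' - \<theta>) / r)"
    unfolding eq using pos lr by simp
  then show "ln (normal_density \<theta> (sqrt r) y' / coord_pred_density P r y y') =
      ln (likelihood_ratio P \<theta> 1 (y - \<theta>))
        - ln (likelihood_ratio P \<theta> (1 + 1 / r) ((y - \<theta>) + (y' - \<theta>) / r))"
    using lr by (simp add: ln_div)
qed

text \<open>The second part controls the growth in \<open>z\<close>, so that the outer expectation over the
  observed coordinate exists as well.\<close>

lemma integrable_ln_likelihood_ratio_future: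
  assumes r: "0 < r"
  shows "integrable lborel (\<lambda>y'. normal_density \<theta> (sqrt r) y' *
      ln (likelihood_ratio P \<theta> (1 + 1 / r) (z + (y' - \<theta>) / r)))"
    and "\<exists>a d. \<forall>z. \<bar>\<integral>y'. normal_density \<theta> (sqrt r) y' *
      ln (likelihood_ratio P \<theta> (1 + 1 / r) (z + (y' - \<theta>) / r)) \<partial>lborel\<bar> \<le> a + d * z\<^sup>2"
proof -
  have c: "0 < 1 + 1 / r" using r by (simp add: add_pos_pos)
  define a where "a = \<bar>ln (measure P {0})\<bar> + (1 + 1 / r) * \<theta>\<^sup>2 / 2 + \<theta>\<^sup>2 / 2"
  define d where "d = 1 / (2 * (1 + 1 / r)) + 1 / 2"
  have ad: "0 \<le> d" "\<And>w. \<bar>ln (likelihood_ratio P \<theta> (1 + 1 / r) w)\<bar> \<le> a + d * w\<^sup>2"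
    unfolding a_def d_def using c abs_ln_likelihood_ratio_le[OF c] by auto
  have bd: "\<bar>ln (likelihood_ratio P \<theta> (1 + 1 / r) (z + (y' - \<theta>) / r))\<bar>
      \<le> (a + 2 * d * z\<^sup>2) + 2 * d / r\<^sup>2 * (y' - \<theta>)\<^sup>2" for z y'
  proof -
    have "(z + (y' - \<theta>) / r)\<^sup>2 \<le> 2 * z\<^sup>2 + 2 * ((y' - \<theta>) / r)\<^sup>2"
      using sum_squares_bound[of z "(y' - \<theta>) / r"] by (simp add: power2_sum)
    then have "d * (z + (y' - \<theta>) / r)\<^sup>2 \<le> d * (2 * z\<^sup>2 + 2 * ((y' - \<theta>) / r)\<^sup>2)"
      using ad(1) by (rule mult_left_mono)
    then show ?thesis using ad(2)[of "z + (y' - \<theta>) / r"]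
      by (simp add: algebra_simps power_divide)
  qed
  have s: "0 < sqrt r" using r by simp
  show int: "integrable lborel (\<lambda>y'. normal_density \<theta> (sqrt r) y' *
      ln (likelihood_ratio P \<theta> (1 + 1 / r) (z + (y' - \<theta>) / r)))" for z
    by (rule integrable_normal_quadratic_bound[OF s _ bd]) measurable
  have "\<bar>\<integral>y'. normal_density \<theta> (sqrt r) y' *
      ln (likelihood_ratio P \<theta> (1 + 1 / r) (z + (y' - \<theta>) / r)) \<partial>lborel\<bar>
      \<le> (a + 2 * d / r) + 2 * d * z\<^sup>2" for z
  proof -
    note q = has_bochner_integral_normal_quadratic[OF s, of \<theta> "a + 2 * d * z\<^sup>2" 0 "2 * d / r\<^sup>2"]
    have "\<bar>\<integral>y'. normal_density \<theta> (sqrt r) y' *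
        ln (likelihood_ratio P \<theta> (1 + 1 / r) (z + (y' - \<theta>) / r)) \<partial>lborel\<bar>
      \<le> (\<integral>y'. normal_density \<theta> (sqrt r) y' *
          (a + 2 * d * z\<^sup>2 + 0 * (y' - \<theta>) + 2 * d / r\<^sup>2 * (y' - \<theta>)\<^sup>2) \<partial>lborel)"
    proof (rule order_trans[OF integral_abs_bound], rule integral_mono)
      show "integrable lborel (\<lambda>y'. \<bar>normal_density \<theta> (sqrt r) y' *
        ln (likelihood_ratio P \<theta> (1 + 1 / r) (z + (y' - \<theta>) / r))\<bar>)"
        using int by (rule integrable_abs)
    qed (use q bd[of z] in \<open>auto simp: abs_mult intro!: mult_left_mono elim: integrable.intros\<close>)
    also have "\<dots> = a + 2 * d * z\<^sup>2 + 2 * d / r\<^sup>2 * (sqrt r)\<^sup>2"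
      using q by (rule has_bochner_integral_integral_eq)
    also have "\<dots> = (a + 2 * d / r) + 2 * d * z\<^sup>2"
      using r by (simp add: power2_eq_square)
    finally show ?thesis .
  qed
  then show "\<exists>a d. \<forall>z. \<bar>\<integral>y'. normal_density \<theta> (sqrt r) y' *
      ln (likelihood_ratio P \<theta> (1 + 1 / r) (z + (y' - \<theta>) / r)) \<partial>lborel\<bar> \<le> a + d * z\<^sup>2"
    by blast
qed

lemma coord_loss_eq:
  assumes r: "0 < r"
  shows "integrable lborel (\<lambda>y'. normal_density \<theta> (sqrt r) y' *
      ln (normal_density \<theta> (sqrt r) y' / coord_pred_density P r y y'))"
    and "coord_loss P r \<theta> y = ln (likelihood_ratio P \<theta> 1 (y - \<theta>)) -
      (\<integral>y'. normal_density \<theta> (sqrt r) y' *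
        ln (likelihood_ratio P \<theta> (1 + 1 / r) ((y - \<theta>) + (y' - \<theta>) / r)) \<partial>lborel)"
  using integrable_ln_likelihood_ratio_future(1)[OF r, of \<theta> "y - \<theta>"] r
  unfolding coord_loss_def ln_coord_ratio_eq(2)[OF r, of \<theta> _ y]
  by (simp_all add: right_diff_distrib)

lemma integrable_coord_loss:
  assumes r: "0 < r"
  shows "integrable lborel (\<lambda>y. normal_density \<theta> 1 y * coord_loss P r \<theta> y)"
proof -
  obtain a d where ad: "\<And>z. \<bar>\<integral>y'. normal_density \<theta> (sqrt r) y' *
      ln (likelihood_ratio P \<theta> (1 + 1 / r) (z + (y' - \<theta>) / r)) \<partial>lborel\<bar> \<le> a + d * z\<^sup>2"
    using integrable_ln_likelihood_ratio_future(2)[OF r] by blast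
  obtain a' d' where ad': "\<And>z. \<bar>ln (likelihood_ratio P \<theta> 1 z)\<bar> \<le> a' + d' * z\<^sup>2"
    using abs_ln_likelihood_ratio_le[OF zero_less_one] by blast
  show ?thesis
  proof (rule integrable_normal_quadratic_bound)
    show "coord_loss P r \<theta> \<in> borel_measurable borel"
      unfolding coord_loss_eq(2)[OF r, abs_def] by measurable
    show "\<bar>coord_loss P r \<theta> y\<bar> \<le> (a + a') + (d + d') * (y - \<theta>)\<^sup>2" for y
      unfolding coord_loss_eq(2)[OF r] using ad[of "y - \<theta>"] ad'[of "y - \<theta>"]
      by (simp add: algebra_simps)
  qed simp
qed

text \<open>The bookkeeping step through which every risk bound goes: a majorant \<open>U\<close> for the
  present log likelihood ratio and a quadratic minorant for the joint one. The joint noise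
  \<open>w = z + z' / r\<close> has mean zero and variance \<open>1 + 1 / r\<close>, which turns the
  quadratic into \<open>\<alpha> + \<gamma> * (1 + 1 / r)\<close>.\<close>

lemma coord_risk_le:
  assumes r: "0 < r"
    and U: "\<And>z. ln (likelihood_ratio P \<theta> 1 z) \<le> U z"
      "has_bochner_integral lborel (\<lambda>y. normal_density \<theta> 1 y * U (y - \<theta>)) u"
    and V: "\<And>w. \<alpha> + \<beta> * w + \<gamma> * w\<^sup>2 \<le> ln (likelihood_ratio P \<theta> (1 + 1 / r) w)"
  shows "coord_risk P r \<theta> \<le> u - (\<alpha> + \<gamma> * (1 + 1 / r))"
proof -
  have s: "0 < sqrt r" using r by simp
  have inner: "\<alpha> + \<gamma> / r + \<beta> * z + \<gamma> * z\<^sup>2 \<le> (\<integral>y'. normal_density \<theta> (sqrt r) y' *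
        ln (likelihood_ratio P \<theta> (1 + 1 / r) (z + (y' - \<theta>) / r)) \<partial>lborel)" for z
  proof -
    note q = has_bochner_integral_normal_quadratic[OF s, of \<theta> "\<alpha> + \<beta> * z + \<gamma> * z\<^sup>2"
        "\<beta> / r + 2 * \<gamma> * z / r" "\<gamma> / r\<^sup>2"]
    have "\<alpha> + \<gamma> / r + \<beta> * z + \<gamma> * z\<^sup>2 = \<alpha> + \<beta> * z + \<gamma> * z\<^sup>2 + \<gamma> / r\<^sup>2 * (sqrt r)\<^sup>2"
      using r by (simp add: power2_eq_square)
    also have "\<dots> = (\<integral>y'. normal_density \<theta> (sqrt r) y' * (\<alpha> + \<beta> * z + \<gamma> * z\<^sup>2
        + (\<beta> / r + 2 * \<gamma> * z / r) * (y' - \<theta>) + \<gamma> / r\<^sup>2 * (y' - \<theta>)\<^sup>2) \<partial>lborel)"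
      using q by (rule has_bochner_integral_integral_eq[symmetric])
    also have "\<dots> \<le> (\<integral>y'. normal_density \<theta> (sqrt r) y' *
        ln (likelihood_ratio P \<theta> (1 + 1 / r) (z + (y' - \<theta>) / r)) \<partial>lborel)"
    proof (rule integral_mono)
      show "integrable lborel (\<lambda>y'. normal_density \<theta> (sqrt r) y' * (\<alpha> + \<beta> * z + \<gamma> * z\<^sup>2
        + (\<beta> / r + 2 * \<gamma> * z / r) * (y' - \<theta>) + \<gamma> / r\<^sup>2 * (y' - \<theta>)\<^sup>2))"
        using q by (rule integrable.intros)
      fix y'
      have "\<alpha> + \<beta> * (z + (y' - \<theta>) / r) + \<gamma> * (z + (y' - \<theta>) / r)\<^sup>2 = \<alpha> + \<beta> * z + \<gamma> * z\<^sup>2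
        + (\<beta> / r + 2 * \<gamma> * z / r) * (y' - \<theta>) + \<gamma> / r\<^sup>2 * (y' - \<theta>)\<^sup>2"
        using r by (simp add: power2_sum power_divide distrib_left distrib_right)
      then show "normal_density \<theta> (sqrt r) y' * (\<alpha> + \<beta> * z + \<gamma> * z\<^sup>2
          + (\<beta> / r + 2 * \<gamma> * z / r) * (y' - \<theta>) + \<gamma> / r\<^sup>2 * (y' - \<theta>)\<^sup>2)
        \<le> normal_density \<theta> (sqrt r) y' *
          ln (likelihood_ratio P \<theta> (1 + 1 / r) (z + (y' - \<theta>) / r))"
        using V[of "z + (y' - \<theta>) / r"] by (intro mult_left_mono) auto
    qed (rule integrable_ln_likelihood_ratio_future(1)[OF r])
    finally show ?thesis .
  qed
  have q: "has_bochner_integral lborel (\<lambda>y. normal_density \<theta> 1 y *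
      (\<alpha> + \<gamma> / r + \<beta> * (y - \<theta>) + \<gamma> * (y - \<theta>)\<^sup>2)) (\<alpha> + \<gamma> / r + \<gamma>)"
    using has_bochner_integral_normal_quadratic[of 1 \<theta> "\<alpha> + \<gamma> / r" \<beta> \<gamma>] by simp
  note d = has_bochner_integral_diff[OF U(2) q]
  have "coord_risk P r \<theta> \<le> (\<integral>y. normal_density \<theta> 1 y * U (y - \<theta>) - normal_density \<theta> 1 y *
      (\<alpha> + \<gamma> / r + \<beta> * (y - \<theta>) + \<gamma> * (y - \<theta>)\<^sup>2) \<partial>lborel)"
    unfolding coord_risk_def
  proof (rule integral_mono)
    show "integrable lborel (\<lambda>y. normal_density \<theta> 1 y * U (y - \<theta>) - normal_density \<theta> 1 y *
      (\<alpha> + \<gamma> / r + \<beta> * (y - \<theta>) + \<gamma> * (y - \<theta>)\<^sup>2))"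
      using d by (rule integrable.intros)
    show "normal_density \<theta> 1 y * coord_loss P r \<theta> y
      \<le> normal_density \<theta> 1 y * U (y - \<theta>) - normal_density \<theta> 1 y *
      (\<alpha> + \<gamma> / r + \<beta> * (y - \<theta>) + \<gamma> * (y - \<theta>)\<^sup>2)" for y
      unfolding right_diff_distrib[symmetric] coord_loss_eq(2)[OF r]
      using U(1)[of "y - \<theta>"] inner[of "y - \<theta>"] by (intro mult_left_mono diff_mono) auto
  qed (rule integrable_coord_loss[OF r])
  also have "\<dots> = u - (\<alpha> + \<gamma> / r + \<gamma>)"
    using d by (rule has_bochner_integral_integral_eq)
  finally show ?thesis by (simp add: algebra_simps)
qed

text \<open>The likelihood ratio has mean one under the true parameter: its product with the true density
  is the marginal density of the observation.\<close>

lemma has_bochner_integral_marginal: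
  "has_bochner_integral lborel (\<lambda>y. normal_density \<theta> 1 y * likelihood_ratio P \<theta> 1 (y - \<theta>)) 1"
proof -
  interpret L: pair_sigma_finite lborel P
    by (rule pair_sigma_finite.intro[OF sigma_finite_lborel sigma_finite_measure_axioms])
  have m: "ennreal (normal_density \<theta> 1 y * likelihood_ratio P \<theta> 1 (y - \<theta>))
      = (\<integral>\<^sup>+t. ennreal (normal_density t 1 y) \<partial>P)" for y
    unfolding marginal_eq_likelihood_ratio[symmetric]
    by (rule nn_integral_eq_integral[symmetric]) (auto simp: integrable_normal_density_mean)
  have "(\<integral>\<^sup>+y. ennreal (normal_density \<theta> 1 y * likelihood_ratio P \<theta> 1 (y - \<theta>)) \<partial>lborel)
      = (\<integral>\<^sup>+t. \<integral>\<^sup>+y. ennreal (normal_density t 1 y) \<partial>lborel \<partial>P)"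
    unfolding m by (rule L.Fubini'[symmetric]) measurable
  also have "\<dots> = (\<integral>\<^sup>+t. 1 \<partial>P)"
    by (intro nn_integral_cong) (simp add: nn_integral_eq_integral)
  also have "\<dots> = 1" by (simp add: emeasure_space_1)
  finally show ?thesis
    using likelihood_ratio_pos[OF zero_less_one, THEN less_imp_le]
    by (intro has_bochner_integral_nn_integral) (auto intro!: mult_nonneg_nonneg)
qed

text \<open>At \<open>\<theta> = 0\<close> the present log likelihood ratio has nonpositive mean, by
  \<open>ln x \<le> x - 1\<close> and the mean-one property, and the joint ratio is at least the mass of
  the atom. This is the bound that makes the many zero coordinates cheap.\<close>

lemma coord_risk_zero_le:
  assumes r: "0 < r"
  shows "coord_risk P r 0 \<le> - ln (measure P {0})"
proof -
  have "has_bochner_integral lborel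
      (\<lambda>y. normal_density 0 1 y * (likelihood_ratio P 0 1 (y - 0) - 1)) 0"
    using has_bochner_integral_diff[OF has_bochner_integral_marginal[of 0]
      has_bochner_integral_normal_quadratic[of 1 0 1 0 0]]
    by (simp add: right_diff_distrib)
  moreover have "0 < 1 + 1 / r" using r by (simp add: add_pos_pos)
  moreover have "ln (likelihood_ratio P 0 1 z) \<le> likelihood_ratio P 0 1 z - 1" for z
    by (rule ln_le_minus_one) (simp add: likelihood_ratio_pos)
  ultimately show ?thesis
    using coord_risk_le[OF r, of 0 "\<lambda>z. likelihood_ratio P 0 1 z - 1" 0 "ln (measure P {0})" 0 0]
      ln_likelihood_ratio_ge[of "1 + 1 / r" 0]
    by simp
qed

section \<open>Product priors\<close>

text \<open>Likelihood and prior are both products, so the posterior integral splits.\<close>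

lemma pred_density_eq_prod:
  assumes r: "0 < r"
  shows "pred_density n r (\<Pi>\<^sub>M i\<in>{..<n}. P) y y' = (\<Prod>i<n. coord_pred_density P r (y i) (y' i))"
proof -
  interpret product_sigma_finite "\<lambda>_::nat. P" ..
  let ?Z = "\<integral>\<theta>. gauss_density n 1 \<theta> y \<partial>(\<Pi>\<^sub>M i\<in>{..<n}. P)"
  have meas: "(\<lambda>\<theta>. gauss_density n w \<theta> u) \<in> borel_measurable (\<Pi>\<^sub>M i\<in>{..<n}. P)" for w u
    unfolding gauss_density_def by measurable
  have nonneg: "0 \<le> gauss_density n w \<theta> u" for w \<theta> u
    by (simp add: gauss_density_def prod_nonneg)
  have "pred_density n r (\<Pi>\<^sub>M i\<in>{..<n}. P) y y' =
      (\<integral>\<theta>. (gauss_density n 1 \<theta> y * gauss_density n r \<theta> y') / ?Z \<partial>(\<Pi>\<^sub>M i\<in>{..<n}. P))"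
    unfolding pred_density_def posterior_def
    by (subst integral_density) (auto simp: nonneg meas intro!: borel_measurable_divide)
  also have "\<dots> = (\<integral>\<theta>. (\<Prod>i<n. normal_density (\<theta> i) 1 (y i) * normal_density (\<theta> i) (sqrt r) (y' i))
      \<partial>(\<Pi>\<^sub>M i\<in>{..<n}. P)) / ?Z"
    by (simp add: gauss_density_def prod.distrib)
  also have "(\<integral>\<theta>. (\<Prod>i<n. normal_density (\<theta> i) 1 (y i) * normal_density (\<theta> i) (sqrt r) (y' i))
      \<partial>(\<Pi>\<^sub>M i\<in>{..<n}. P)) = (\<Prod>i<n. \<integral>t. normal_density t 1 (y i) * normal_density t (sqrt r) (y' i) \<partial>P)"
    by (rule product_integral_prod) (simp_all add: integrable_joint_normal_density_mean r)
  also have "?Z = (\<Prod>i<n. \<integral>t. normal_density t 1 (y i) \<partial>P)"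
    unfolding gauss_density_def real_sqrt_one
    by (rule product_integral_prod) (simp_all add: integrable_normal_density_mean)
  finally show ?thesis
    by (simp add: coord_pred_density_def prod_dividef)
qed

lemma pred_risk_eq_sum:
  assumes r: "0 < r"
  shows "pred_risk n r \<theta> (pred_density n r (\<Pi>\<^sub>M i\<in>{..<n}. P)) = ereal (\<Sum>i<n. coord_risk P r (\<theta> i))"
proof -
  have s: "0 < sqrt r" using r by simp
  have loss: "gauss_density n r \<theta> y' * ln (gauss_density n r \<theta> y' / pred_density n r (\<Pi>\<^sub>M i\<in>{..<n}. P) y y')
      = (\<Prod>i<n. normal_density (\<theta> i) (sqrt r) (y' i)) *
        (\<Sum>i<n. ln (normal_density (\<theta> i) (sqrt r) (y' i) / coord_pred_density P r (y i) (y' i)))" for y y'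
    unfolding pred_density_eq_prod[OF r] gauss_density_def prod_dividef[symmetric]
    using normal_density_pos[OF s] ln_coord_ratio_eq(1)[OF r]
    by (subst ln_prod) (simp_all add: less_imp_neq[symmetric])
  have inner: "ext_integral (lebesgue_prod n) (\<lambda>y'. ereal (gauss_density n r \<theta> y' *
      ln (gauss_density n r \<theta> y' / pred_density n r (\<Pi>\<^sub>M i\<in>{..<n}. P) y y')))
      = ereal (\<Sum>i<n. coord_loss P r (\<theta> i) (y i))" for y
  proof -
    have "has_bochner_integral (lebesgue_prod n) (\<lambda>y'. gauss_density n r \<theta> y' *
        ln (gauss_density n r \<theta> y' / pred_density n r (\<Pi>\<^sub>M i\<in>{..<n}. P) y y'))
        (\<Sum>i<n. coord_loss P r (\<theta> i) (y i))"
      unfolding loss coord_loss_def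
      by (rule has_bochner_integral_prod_density_sum)
         (auto simp: s r intro!: coord_loss_eq(1))
    then show ?thesis
      by (simp add: ext_integral_eq_integral has_bochner_integral_iff)
  qed
  have "has_bochner_integral (lebesgue_prod n)
      (\<lambda>y. gauss_density n 1 \<theta> y * (\<Sum>i<n. coord_loss P r (\<theta> i) (y i))) (\<Sum>i<n. coord_risk P r (\<theta> i))"
    unfolding gauss_density_def real_sqrt_one coord_risk_def
    by (rule has_bochner_integral_prod_density_sum) (auto simp: r integrable_coord_loss)
  then show ?thesis
    unfolding pred_risk_def inner times_ereal.simps
    by (simp add: ext_integral_eq_integral has_bochner_integral_iff)
qed

end

section \<open>The spike-and-slab prior on the line\<close>

text \<open>The Laplace density is the symmetrised exponential density, except at the origin.\<close>

lemma nn_integral_laplace_density: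
  assumes "0 < l"
  shows "(\<integral>\<^sup>+x. ennreal (laplace_density l x) \<partial>lborel) = 1"
proof -
  have e: "(\<integral>\<^sup>+x. ennreal (exponential_density l x) \<partial>lborel) = 1"
    using prob_space.emeasure_space_1[OF prob_space_exponential_density[OF assms]]
    by (simp add: emeasure_density)
  have "AE x in lborel. ennreal (laplace_density l x) =
      ennreal (1 / 2) * (ennreal (exponential_density l x) + ennreal (exponential_density l (- x)))"
    using AE_lborel_singleton[of 0]
  proof eventually_elim
    case (elim x)
    have "laplace_density l x = 1 / 2 * (exponential_density l x + exponential_density l (- x))"
      using elim by (auto simp: laplace_density_def exponential_density_def mult.commute)
    then show ?case
      using assms exponential_density_nonneg[OF assms]
      by (simp only: ennreal_mult' ennreal_plus)
  qed
  then have "(\<integral>\<^sup>+x. ennreal (laplace_density l x) \<partial>lborel) =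
      (\<integral>\<^sup>+x. ennreal (1 / 2) * (ennreal (exponential_density l x) + ennreal (exponential_density l (- x))) \<partial>lborel)"
    by (rule nn_integral_cong_AE)
  also have "\<dots> = ennreal (1 / 2) * (1 + (\<integral>\<^sup>+x. ennreal (exponential_density l (- x)) \<partial>lborel))"
    by (simp add: nn_integral_cmult nn_integral_add e del: ennreal_half)
  also have "(\<integral>\<^sup>+x. ennreal (exponential_density l (- x)) \<partial>lborel) = 1"
    using nn_integral_real_affine[of "\<lambda>x. ennreal (exponential_density l x)" "-1" 0] e by simp
  also have "ennreal (1 / 2) * (1 + 1) = ennreal (1 / 2 * (1 + 1))"
    by (subst ennreal_mult', simp, subst ennreal_plus) (simp_all del: ennreal_half)
  also have "\<dots> = 1" by simp
  finally show ?thesis .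
qed

lemma nn_integral_spike_slab1:
  assumes f: "f \<in> borel_measurable borel"
  shows "(\<integral>\<^sup>+t. f t \<partial>spike_slab1 l \<eta>) =
    ennreal \<eta> * (\<integral>\<^sup>+t. ennreal (laplace_density l t) * f t \<partial>lborel) + ennreal (1 - \<eta>) * f 0"
proof -
  let ?D = "density lborel (\<lambda>x. ennreal (laplace_density l x))"
  have [measurable]: "laplace_density l \<in> borel_measurable borel"
    unfolding laplace_density_def[abs_def] by measurable
  let ?P = "spike_slab1 l \<eta>" and ?R = "return borel (0::real)"
  have sets: "sets ?D = sets borel" "sets ?P = sets borel" "sets ?R = sets borel"
    by (simp_all add: sets_spike_slab1)
  note [simp] = sets[THEN measurable_cong_sets, OF refl]
  have "(\<integral>\<^sup>+t. f t \<partial>?P) = ennreal \<eta> * (\<integral>\<^sup>+t. f t \<partial>?D) + ennreal (1 - \<eta>) * (\<integral>\<^sup>+t. f t \<partial>?R)"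
    using f
  proof (induction rule: borel_measurable_induct)
    case (cong f g)
    then have "f = g" by auto
    with cong show ?case by simp
  next
    case (set A)
    then show ?case by (simp add: sets nn_integral_indicator emeasure_spike_slab1 del: nn_integral_return)
  next
    case (mult u c)
    have "integral\<^sup>N M (\<lambda>t. c * u t) = c * integral\<^sup>N M u" if "sets M = sets borel" for M
      using mult(2) by (intro nn_integral_cmult) (simp add: measurable_cong_sets[OF that refl])
    then show ?case using mult by (simp only: sets distrib_left mult.left_commute)
  next
    case (add u v)
    have "integral\<^sup>N M (\<lambda>t. v t + u t) = integral\<^sup>N M v + integral\<^sup>N M u" if "sets M = sets borel" for M
      using add by (intro nn_integral_add) (simp_all add: measurable_cong_sets[OF that refl])
    then show ?case using add by (simp only: sets distrib_left ac_simps)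
  next
    case (seq U)
    have int: "(\<integral>\<^sup>+t. (SUP i. U i) t \<partial>M) = (SUP i. \<integral>\<^sup>+t. U i t \<partial>M)" if "sets M = sets borel" for M
      unfolding SUP_apply
      using seq by (intro nn_integral_monotone_convergence_SUP)
        (simp_all add: measurable_cong_sets[OF that refl])
    have mono: "incseq (\<lambda>i. a * (\<integral>\<^sup>+t. U i t \<partial>M))" for M and a :: ennreal
      using seq by (auto simp: incseq_def le_fun_def intro!: nn_integral_mono mult_left_mono)
    have "(\<integral>\<^sup>+t. (SUP i. U i) t \<partial>?P) = (SUP i. ennreal \<eta> * (\<integral>\<^sup>+t. U i t \<partial>?D) + ennreal (1 - \<eta>) * (\<integral>\<^sup>+t. U i t \<partial>?R))"
      unfolding int[OF sets(2)] seq.IH ..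
    also have "\<dots> = ennreal \<eta> * (SUP i. \<integral>\<^sup>+t. U i t \<partial>?D) + ennreal (1 - \<eta>) * (SUP i. \<integral>\<^sup>+t. U i t \<partial>?R)"
      unfolding SUP_mult_left_ennreal using mono by (intro ennreal_SUP_add)
    finally show ?case
      unfolding int[OF sets(1)] int[OF sets(3)] .
  qed
  then show ?thesis
    using f by (simp add: nn_integral_density nn_integral_return)
qed

lemma spike_prior_spike_slab1:
  assumes "0 < l" "0 < \<eta>" "\<eta> < 1"
  shows "spike_prior (spike_slab1 l \<eta>)" and "measure (spike_slab1 l \<eta>) {0} = 1 - \<eta>"
proof -
  have [measurable]: "laplace_density l \<in> borel_measurable borel"
    unfolding laplace_density_def[abs_def] by measurable
  have "emeasure (spike_slab1 l \<eta>) {0} = ennreal (1 - \<eta>)"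
    by (simp add: emeasure_spike_slab1 emeasure_density nn_integral_null_set[where N = "{0}"])
  then show m: "measure (spike_slab1 l \<eta>) {0} = 1 - \<eta>"
    using assms by (simp add: measure_def)
  have "emeasure (spike_slab1 l \<eta>) UNIV = ennreal \<eta> + ennreal (1 - \<eta>)"
    using assms by (simp add: emeasure_spike_slab1 emeasure_density nn_integral_laplace_density)
  also have "\<dots> = 1" using assms by (simp flip: ennreal_plus)
  finally have "prob_space (spike_slab1 l \<eta>)"
    using sets_eq_imp_space_eq[OF sets_spike_slab1, of l \<eta>] by (intro prob_spaceI) simp
  then show "spike_prior (spike_slab1 l \<eta>)"
    using m assms by (simp add: spike_prior_def spike_prior_axioms_def sets_spike_slab1)
qed

lemma likelihood_ratio_spike_slab1:
  assumes "0 < l" "0 < \<eta>" "\<eta> < 1" "0 < c"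
  shows "ennreal (likelihood_ratio (spike_slab1 l \<eta>) \<theta> c w) =
    ennreal \<eta> * (\<integral>\<^sup>+t. ennreal (laplace_density l t * exp ((t - \<theta>) * w - c * (t - \<theta>)\<^sup>2 / 2)) \<partial>lborel)
    + ennreal ((1 - \<eta>) * exp (- \<theta> * w - c * \<theta>\<^sup>2 / 2))"
proof -
  interpret spike_prior "spike_slab1 l \<eta>" using assms by (intro spike_prior_spike_slab1)
  have "ennreal (likelihood_ratio (spike_slab1 l \<eta>) \<theta> c w) =
      (\<integral>\<^sup>+t. ennreal (exp ((t - \<theta>) * w - c * (t - \<theta>)\<^sup>2 / 2)) \<partial>spike_slab1 l \<eta>)"
    unfolding likelihood_ratio_def
    using integrable_likelihood_ratio[OF assms(4)] by (intro nn_integral_eq_integral[symmetric]) auto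
  moreover have "0 \<le> laplace_density l t" for t
    using assms by (simp add: laplace_density_def)
  ultimately show ?thesis
    using assms by (simp add: nn_integral_spike_slab1 ennreal_mult')
qed

text \<open>Since \<open>\<bar>t\<bar> \<ge> \<bar>\<theta>\<bar> - \<bar>t - \<theta>\<bar>\<close>, the slab costs
  a factor \<open>exp (- l * \<bar>\<theta>\<bar>)\<close>, while half of the Gaussian exponent absorbs the
  terms linear in \<open>t - \<theta>\<close>. What is left is a Gaussian density of variance 2.\<close>

lemma slab_likelihood_ratio_le:
  assumes "0 < l"
  shows "(\<integral>\<^sup>+t. ennreal (laplace_density l t * exp ((t - \<theta>) * z - 1 * (t - \<theta>)\<^sup>2 / 2)) \<partial>lborel)
    \<le> ennreal (l * sqrt pi * exp (2 * l\<^sup>2 - l * \<bar>\<theta>\<bar> + 2 * z\<^sup>2))"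
proof -
  let ?C = "l * sqrt pi * exp (2 * l\<^sup>2 - l * \<bar>\<theta>\<bar> + 2 * z\<^sup>2)"
  have "laplace_density l t * exp ((t - \<theta>) * z - 1 * (t - \<theta>)\<^sup>2 / 2)
      \<le> ?C * normal_density \<theta> (sqrt 2) t" for t
  proof -
    define x where "x = \<bar>t - \<theta>\<bar>"
    have "(t - \<theta>) * z \<le> x * \<bar>z\<bar>"
      unfolding x_def by (metis abs_ge_self abs_mult)
    moreover have "- l * \<bar>t\<bar> \<le> - l * \<bar>\<theta>\<bar> + l * x"
      using mult_left_mono[of "\<bar>\<theta>\<bar>" "\<bar>t\<bar> + x" l] assms by (simp add: x_def algebra_simps)
    moreover have "x * (\<bar>z\<bar> + l) \<le> x\<^sup>2 / 4 + (\<bar>z\<bar> + l)\<^sup>2"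
      using sum_squares_bound[of "x / 2" "\<bar>z\<bar> + l"] by (simp add: power_divide)
    moreover have "(\<bar>z\<bar> + l)\<^sup>2 \<le> 2 * z\<^sup>2 + 2 * l\<^sup>2"
      using sum_squares_bound[of "\<bar>z\<bar>" l] by (simp add: power2_sum)
    moreover have "x\<^sup>2 = (t - \<theta>)\<^sup>2" by (simp add: x_def)
    ultimately have "- l * \<bar>t\<bar> + ((t - \<theta>) * z - (t - \<theta>)\<^sup>2 / 2)
        \<le> (2 * l\<^sup>2 - l * \<bar>\<theta>\<bar> + 2 * z\<^sup>2) + - (t - \<theta>)\<^sup>2 / (2 * (sqrt 2)\<^sup>2)"
      by (simp add: distrib_left mult.commute[of x l])
    then have "exp (- l * \<bar>t\<bar>) * exp ((t - \<theta>) * z - (t - \<theta>)\<^sup>2 / 2)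
        \<le> exp (2 * l\<^sup>2 - l * \<bar>\<theta>\<bar> + 2 * z\<^sup>2) * exp (- (t - \<theta>)\<^sup>2 / (2 * (sqrt 2)\<^sup>2))"
      unfolding exp_add[symmetric] by simp
    from mult_left_mono[OF this, of "l / 2"] show ?thesis
      using assms by (simp add: laplace_density_def normal_density_def real_sqrt_mult)
  qed
  then have "(\<integral>\<^sup>+t. ennreal (laplace_density l t * exp ((t - \<theta>) * z - 1 * (t - \<theta>)\<^sup>2 / 2)) \<partial>lborel)
    \<le> (\<integral>\<^sup>+t. ennreal (?C * normal_density \<theta> (sqrt 2) t) \<partial>lborel)"
    by (intro nn_integral_mono ennreal_leI)
  also have "\<dots> = ennreal (\<integral>t. ?C * normal_density \<theta> (sqrt 2) t \<partial>lborel)"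
    using assms by (intro nn_integral_eq_integral) auto
  also have "\<dots> = ennreal ?C" by simp
  finally show ?thesis .
qed

text \<open>Keep only the part of the slab within distance one of \<open>\<theta>\<close>.\<close>

lemma slab_likelihood_ratio_ge:
  assumes "0 < l" "0 < c"
  shows "ennreal (l * exp (- l * (\<bar>\<theta>\<bar> + 1) - \<bar>w\<bar> - c / 2)) \<le>
    (\<integral>\<^sup>+t. ennreal (laplace_density l t * exp ((t - \<theta>) * w - c * (t - \<theta>)\<^sup>2 / 2)) \<partial>lborel)"
proof -
  let ?C = "l / 2 * exp (- l * (\<bar>\<theta>\<bar> + 1) - \<bar>w\<bar> - c / 2)"
  have le: "?C \<le> laplace_density l t * exp ((t - \<theta>) * w - c * (t - \<theta>)\<^sup>2 / 2)"
    if t: "\<bar>t - \<theta>\<bar> \<le> 1" for t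
  proof -
    have "l * \<bar>t\<bar> \<le> l * (\<bar>\<theta>\<bar> + 1)"
      using t assms by (intro mult_left_mono) auto
    moreover have "- \<bar>w\<bar> \<le> (t - \<theta>) * w"
      using mult_left_le_one_le[of "\<bar>w\<bar>" "\<bar>t - \<theta>\<bar>"] t
      by (simp add: abs_mult[symmetric] abs_le_iff)
    moreover have "c * (t - \<theta>)\<^sup>2 \<le> c * 1"
      using t assms by (intro mult_left_mono) (auto simp: abs_square_le_1)
    ultimately have "- l * (\<bar>\<theta>\<bar> + 1) - \<bar>w\<bar> - c / 2
        \<le> - l * \<bar>t\<bar> + ((t - \<theta>) * w - c * (t - \<theta>)\<^sup>2 / 2)" by simp
    then have "exp (- l * (\<bar>\<theta>\<bar> + 1) - \<bar>w\<bar> - c / 2)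
        \<le> exp (- l * \<bar>t\<bar>) * exp ((t - \<theta>) * w - c * (t - \<theta>)\<^sup>2 / 2)"
      unfolding exp_add[symmetric] by simp
    from mult_left_mono[OF this, of "l / 2"] show ?thesis
      using assms by (simp add: laplace_density_def)
  qed
  have "ennreal (l * exp (- l * (\<bar>\<theta>\<bar> + 1) - \<bar>w\<bar> - c / 2)) =
      ennreal ?C * ennreal ((\<theta> + 1) - (\<theta> - 1))"
    using assms by (subst ennreal_mult'[symmetric]) auto
  also have "\<dots> = (\<integral>\<^sup>+t. ennreal ?C * indicator {\<theta> - 1..\<theta> + 1} t \<partial>lborel)"
    by (simp add: nn_integral_cmult_indicator)
  also have "\<dots> \<le> (\<integral>\<^sup>+t. ennreal (laplace_density l t * exp ((t - \<theta>) * w - c * (t - \<theta>)\<^sup>2 / 2)) \<partial>lborel)"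
    using le by (intro nn_integral_mono) (auto simp: indicator_def intro!: ennreal_leI)
  finally show ?thesis .
qed

lemma ln_spike_slab_likelihood_ratio_ge:
  assumes "0 < l" "0 < \<eta>" "\<eta> < 1" "0 < c"
  shows "ln \<eta> + ln l - l * (\<bar>\<theta>\<bar> + 1) - \<bar>w\<bar> - c / 2
    \<le> ln (likelihood_ratio (spike_slab1 l \<eta>) \<theta> c w)"
proof -
  interpret spike_prior "spike_slab1 l \<eta>" using assms by (intro spike_prior_spike_slab1)
  let ?T = "likelihood_ratio (spike_slab1 l \<eta>) \<theta> c w"
  let ?B = "exp (- l * (\<bar>\<theta>\<bar> + 1) - \<bar>w\<bar> - c / 2)"
  have T: "0 < ?T" by (rule likelihood_ratio_pos[OF assms(4)])
  have "ennreal (\<eta> * (l * ?B)) = ennreal \<eta> * ennreal (l * ?B)"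
    using assms by (intro ennreal_mult') simp
  also have "\<dots> \<le> ennreal \<eta> * (\<integral>\<^sup>+t. ennreal (laplace_density l t * exp ((t - \<theta>) * w - c * (t - \<theta>)\<^sup>2 / 2)) \<partial>lborel)"
    by (intro mult_left_mono slab_likelihood_ratio_ge assms) simp
  also have "\<dots> \<le> ennreal ?T"
    unfolding likelihood_ratio_spike_slab1[OF assms] by simp
  finally have "\<eta> * (l * ?B) \<le> ?T" using T by (simp add: ennreal_le_iff)
  then have "ln (\<eta> * (l * ?B)) \<le> ln ?T" using assms T by (subst ln_le_cancel_iff) auto
  then show ?thesis using assms by (simp add: ln_mult)
qed

text \<open>The ratio is a sum of a spike and a slab part, hence at most twice the larger one. The part
  that dominates decides between large and moderate means below.\<close>

lemma ln_spike_slab_likelihood_ratio_le: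
  assumes "0 < l" "0 < \<eta>" "\<eta> < 1"
  shows "ln (likelihood_ratio (spike_slab1 l \<eta>) \<theta> 1 z) \<le>
    ln 2 + max (- \<theta> * z - \<theta>\<^sup>2 / 2) (ln \<eta> - l * \<bar>\<theta>\<bar> + (\<bar>ln (l * sqrt pi)\<bar> + 2 * l\<^sup>2 + 2 * z\<^sup>2))"
proof -
  interpret spike_prior "spike_slab1 l \<eta>" using assms by (intro spike_prior_spike_slab1)
  let ?T = "likelihood_ratio (spike_slab1 l \<eta>) \<theta> 1 z"
  let ?E = "exp (2 * l\<^sup>2 - l * \<bar>\<theta>\<bar> + 2 * z\<^sup>2)"
  define M where "M = max (- \<theta> * z - \<theta>\<^sup>2 / 2) (ln \<eta> - l * \<bar>\<theta>\<bar> + (\<bar>ln (l * sqrt pi)\<bar> + 2 * l\<^sup>2 + 2 * z\<^sup>2))"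
  have T: "0 < ?T" by (rule likelihood_ratio_pos) simp
  have "ennreal ?T \<le> ennreal \<eta> * ennreal (l * sqrt pi * ?E) + ennreal ((1 - \<eta>) * exp (- \<theta> * z - 1 * \<theta>\<^sup>2 / 2))"
    unfolding likelihood_ratio_spike_slab1[OF assms zero_less_one]
    by (intro add_right_mono mult_left_mono slab_likelihood_ratio_le assms) simp
  also have "\<dots> = ennreal (\<eta> * (l * sqrt pi * ?E) + (1 - \<eta>) * exp (- \<theta> * z - 1 * \<theta>\<^sup>2 / 2))"
    using assms by (subst ennreal_plus) (simp_all add: ennreal_mult')
  finally have "?T \<le> \<eta> * (l * sqrt pi * ?E) + (1 - \<eta>) * exp (- \<theta> * z - 1 * \<theta>\<^sup>2 / 2)"
    using assms by (subst (asm) ennreal_le_iff) auto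
  also have "\<dots> \<le> exp M + exp M"
  proof (rule add_mono)
    have "\<eta> * (l * sqrt pi * ?E) = exp (ln \<eta> + ln (l * sqrt pi) + (2 * l\<^sup>2 - l * \<bar>\<theta>\<bar> + 2 * z\<^sup>2))"
      using assms by (simp add: exp_add)
    also have "\<dots> \<le> exp M"
      using abs_ge_self[of "ln (l * sqrt pi)"] unfolding M_def by simp
    finally show "\<eta> * (l * sqrt pi * ?E) \<le> exp M" .
    have "(1 - \<eta>) * exp (- \<theta> * z - 1 * \<theta>\<^sup>2 / 2) \<le> 1 * exp (- \<theta> * z - 1 * \<theta>\<^sup>2 / 2)"
      using assms by (intro mult_right_mono) auto
    also have "\<dots> \<le> exp M" unfolding M_def by simp
    finally show "(1 - \<eta>) * exp (- \<theta> * z - 1 * \<theta>\<^sup>2 / 2) \<le> exp M" .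
  qed
  also have "\<dots> = 2 * exp M" by simp
  finally have "ln ?T \<le> ln (2 * exp M)" using T by (subst ln_le_cancel_iff) auto
  also have "\<dots> = ln 2 + M" by (simp add: ln_mult)
  finally show ?thesis unfolding M_def .
qed

section \<open>Risk of a single coordinate\<close>

text \<open>The two entries of the minimum come from bounding the joint likelihood ratio below by the spike
  and by the slab. The majorant \<open>U\<close> is left open, to be chosen according to the size of
  \<open>\<theta>\<close>.\<close>

lemma spike_slab_coord_risk_le:
  assumes l: "0 < l" and \<eta>: "0 < \<eta>" "\<eta> \<le> 1 / 2" and r: "0 < r"
    and U: "\<And>z. ln (likelihood_ratio (spike_slab1 l \<eta>) \<theta> 1 z) \<le> U z"
      "has_bochner_integral lborel (\<lambda>y. normal_density \<theta> 1 y * U (y - \<theta>)) u"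
  shows "coord_risk (spike_slab1 l \<eta>) r \<theta> \<le> u +
    min ((1 + 1 / r) * (\<theta>\<^sup>2 / 2) + 1) (- ln \<eta> + l * \<bar>\<theta>\<bar> + (\<bar>ln l\<bar> + l + (1 + 1 / r) + 1 / 2))"
proof -
  interpret spike_prior "spike_slab1 l \<eta>" using l \<eta> by (intro spike_prior_spike_slab1) auto
  define c where "c = 1 + 1 / r"
  let ?T = "likelihood_ratio (spike_slab1 l \<eta>) \<theta>"
  have c: "0 < c" using r by (simp add: c_def add_pos_pos)
  have \<eta>1: "\<eta> < 1" using \<eta> by simp
  note m = spike_prior_spike_slab1(2)[OF l \<eta>(1) \<eta>1]
  have "coord_risk (spike_slab1 l \<eta>) r \<theta> \<le> u - ((ln (1 - \<eta>) - c * \<theta>\<^sup>2 / 2) + 0 * c)"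
    unfolding c_def
  proof (rule coord_risk_le[OF r U], fold c_def)
    show "(ln (1 - \<eta>) - c * \<theta>\<^sup>2 / 2) + (- \<theta>) * w + 0 * w\<^sup>2 \<le> ln (?T c w)" for w
      using ln_likelihood_ratio_ge[OF c, of \<theta> w] by (simp add: m)
  qed
  moreover have "- ln (1 - \<eta>) \<le> 1"
  proof -
    have "ln (1 / 2) \<le> ln (1 - \<eta>)" using \<eta> by (subst ln_le_cancel_iff) auto
    then show ?thesis using ln_2_less_1 by (simp add: ln_div)
  qed
  ultimately have spike: "coord_risk (spike_slab1 l \<eta>) r \<theta> \<le> u + (c * (\<theta>\<^sup>2 / 2) + 1)"
    by simp
  have "coord_risk (spike_slab1 l \<eta>) r \<theta>
      \<le> u - ((ln \<eta> + ln l - l * (\<bar>\<theta>\<bar> + 1) - c / 2 - 1 / 2) + (- 1 / 2) * c)"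
    unfolding c_def
  proof (rule coord_risk_le[OF r U], fold c_def)
    fix w :: real
    \<comment> \<open>The minorant has to be quadratic in \<open>w\<close>.\<close>
    have "\<bar>w\<bar> \<le> 1 / 2 + w\<^sup>2 / 2" using sum_squares_bound[of 1 "\<bar>w\<bar>"] by simp
    then show "(ln \<eta> + ln l - l * (\<bar>\<theta>\<bar> + 1) - c / 2 - 1 / 2) + 0 * w + (- 1 / 2) * w\<^sup>2 \<le> ln (?T c w)"
      using ln_spike_slab_likelihood_ratio_ge[OF l \<eta>(1) \<eta>1 c, of \<theta> w] by simp
  qed
  moreover have "- ln l \<le> \<bar>ln l\<bar>" by simp
  ultimately have slab: "coord_risk (spike_slab1 l \<eta>) r \<theta>
      \<le> u + (- ln \<eta> + l * \<bar>\<theta>\<bar> + (\<bar>ln l\<bar> + l + c + 1 / 2))"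
    by (simp add: distrib_left)
  show ?thesis
    using spike slab unfolding min_add_distrib_right c_def[symmetric] by (simp add: min_def)
qed

text \<open>Here \<open>a\<close> will be \<open>- ln \<eta>\<close> and \<open>x = \<theta>\<^sup>2 / 2\<close>. The
  worst case \<open>c * x = a\<close> is a mean at which joint data just begin to prefer the slab while
  the observed data still prefer the spike; there the left side equals the right side.\<close>

lemma min_scaled_diff_le:
  fixes a x c :: real
  assumes "0 \<le> a" "0 \<le> x" "1 \<le> c"
  shows "min (c * x) a - min x a \<le> (1 - 1 / c) * a"
proof (cases "x \<le> a")
  case True
  have "min (c * x) a = 1 / c * min (c * x) a + (1 - 1 / c) * min (c * x) a"
    by (simp add: algebra_simps)
  also have "\<dots> \<le> 1 / c * (c * x) + (1 - 1 / c) * a"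
    using assms by (intro add_mono mult_left_mono) auto
  finally show ?thesis using True assms by simp
next
  case False
  then have "min x a = a" by simp
  moreover have "0 \<le> (1 - 1 / c) * a" using assms by (intro mult_nonneg_nonneg) auto
  ultimately show ?thesis using min.cobounded2[of "c * x" a] by linarith
qed

text \<open>For large means the spike is implausible already after the first observation. Up to constants
  both log likelihood ratios then have mean \<open>ln \<eta> - l * \<bar>\<theta>\<bar>\<close>, so these
  unbounded terms cancel and the risk is bounded.\<close>

lemma spike_slab_coord_risk_large:
  assumes l: "0 < l" and \<eta>: "0 < \<eta>" "\<eta> \<le> 1 / 2" and r: "0 < r"
    and \<theta>: "- ln \<eta> + l * \<bar>\<theta>\<bar> \<le> \<theta>\<^sup>2 / 4"
  shows "coord_risk (spike_slab1 l \<eta>) r \<theta> \<le>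
    ln 2 + \<bar>ln (l * sqrt pi)\<bar> + 2 * l\<^sup>2 + 4 + (\<bar>ln l\<bar> + l + (1 + 1 / r) + 1 / 2)"
proof -
  define b where "b = ln 2 + ln \<eta> - l * \<bar>\<theta>\<bar> + \<bar>ln (l * sqrt pi)\<bar> + 2 * l\<^sup>2"
  define U where "U z = (b + 0 * z + 2 * z\<^sup>2) + 2 * exp (- \<theta> * z / 2 - \<theta>\<^sup>2 / 8)" for z
  have "ln (likelihood_ratio (spike_slab1 l \<eta>) \<theta> 1 z) \<le> U z" for z
  proof -
    \<comment> \<open>The excess of the spike exponent over the slab exponent is at most twice this left side; half
      of it is exponentiated because that exponential has mean one, uniformly in \<open>\<theta>\<close>.\<close>
    have "- \<theta> * z / 2 - \<theta>\<^sup>2 / 8 \<le> exp (- \<theta> * z / 2 - \<theta>\<^sup>2 / 8)"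
      using exp_ge_add_one_self[of "- \<theta> * z / 2 - \<theta>\<^sup>2 / 8"] by linarith
    moreover have "0 \<le> exp (- \<theta> * z / 2 - \<theta>\<^sup>2 / 8)" "0 \<le> \<bar>ln (l * sqrt pi)\<bar>" "0 \<le> z\<^sup>2" "0 \<le> l\<^sup>2"
      by simp_all
    ultimately show ?thesis
      using ln_spike_slab_likelihood_ratio_le[OF l \<eta>(1), of \<theta> z] \<eta>(2) \<theta>
      unfolding U_def b_def by linarith
  qed
  moreover have "has_bochner_integral lborel (\<lambda>y. normal_density \<theta> 1 y * U (y - \<theta>)) (b + 2 + 2)"
    using has_bochner_integral_add[OF has_bochner_integral_normal_quadratic[of 1 \<theta> b 0 2]
      has_bochner_integral_mult_right[OF has_bochner_integral_normal_half_tilt[of \<theta>], of 2]]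
    unfolding U_def by (simp add: distrib_left mult.left_commute)
  ultimately have "coord_risk (spike_slab1 l \<eta>) r \<theta> \<le> b + 2 + 2 +
    min ((1 + 1 / r) * (\<theta>\<^sup>2 / 2) + 1) (- ln \<eta> + l * \<bar>\<theta>\<bar> + (\<bar>ln l\<bar> + l + (1 + 1 / r) + 1 / 2))"
    by (rule spike_slab_coord_risk_le[OF l \<eta> r])
  then show ?thesis unfolding b_def by linarith
qed

text \<open>In the remaining range \<open>\<bar>\<theta>\<bar>\<close> is of order \<open>sqrt (- ln \<eta>)\<close>
  at most, so terms linear in \<open>\<theta>\<close> are a small fraction of \<open>- ln \<eta>\<close>. The
  main term is the difference of minima estimated above, with factor
  \<open>1 - 1 / (1 + 1 / r) = 1 / (1 + r)\<close>; the second \<open>1 / (1 + r)\<close> in the bound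
  pays for the linear terms.\<close>

lemma spike_slab_coord_risk_moderate:
  assumes l: "0 < l" and \<eta>: "0 < \<eta>" "\<eta> \<le> 1 / 2" and r: "0 < r"
    and \<theta>: "\<theta>\<^sup>2 / 4 \<le> - ln \<eta> + l * \<bar>\<theta>\<bar>"
  shows "coord_risk (spike_slab1 l \<eta>) r \<theta> \<le>
    ln 2 + \<bar>ln (l * sqrt pi)\<bar> + 4 * l\<^sup>2 + 3 + (\<bar>ln l\<bar> + l + (1 + 1 / r) + 1 / 2)
      + 2 * (1 + l)\<^sup>2 * (1 + r) + 2 * (1 / (1 + r)) * (- ln \<eta>)"
proof -
  define L where "L = - ln \<eta>"
  define e where "e = 1 / (1 + r)"
  define b where "b = ln 2 - min (\<theta>\<^sup>2 / 2) L + \<bar>ln (l * sqrt pi)\<bar> + 2 * l\<^sup>2"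
  define U where "U z = b + \<bar>\<theta>\<bar> / 2 + 0 * z + (2 + \<bar>\<theta>\<bar> / 2) * z\<^sup>2" for z
  have L: "0 \<le> L" using \<eta> by (simp add: L_def ln_le_zero_iff)
  have e: "0 < e" "e < 1" using r by (auto simp: e_def)
  have "ln (likelihood_ratio (spike_slab1 l \<eta>) \<theta> 1 z) \<le> U z" for z
  proof -
    have "- \<theta> * z \<le> \<bar>\<theta>\<bar> * \<bar>z\<bar>" by (metis abs_ge_self abs_minus_cancel abs_mult)
    also have "\<dots> \<le> \<bar>\<theta>\<bar> * (1 / 2 + z\<^sup>2 / 2)"
      using sum_squares_bound[of 1 "\<bar>z\<bar>"] by (intro mult_left_mono) auto
    finally have "- \<theta> * z \<le> \<bar>\<theta>\<bar> / 2 + \<bar>\<theta>\<bar> / 2 * z\<^sup>2" by (simp add: algebra_simps)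
    moreover have "0 \<le> \<bar>\<theta>\<bar> / 2 * z\<^sup>2" "0 \<le> \<bar>\<theta>\<bar>" "0 \<le> l * \<bar>\<theta>\<bar>" "0 \<le> \<bar>ln (l * sqrt pi)\<bar>" "0 \<le> z\<^sup>2" "0 \<le> l\<^sup>2"
      using l by simp_all
    ultimately show ?thesis
      using ln_spike_slab_likelihood_ratio_le[OF l \<eta>(1), of \<theta> z] \<eta>(2)
      unfolding U_def b_def L_def distrib_right by linarith
  qed
  moreover have "has_bochner_integral lborel (\<lambda>y. normal_density \<theta> 1 y * U (y - \<theta>))
      (b + \<bar>\<theta>\<bar> / 2 + (2 + \<bar>\<theta>\<bar> / 2) * 1\<^sup>2)"
    unfolding U_def by (rule has_bochner_integral_normal_quadratic) simp
  ultimately have "coord_risk (spike_slab1 l \<eta>) r \<theta> \<le> b + \<bar>\<theta>\<bar> / 2 + (2 + \<bar>\<theta>\<bar> / 2) * 1\<^sup>2 +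
    min ((1 + 1 / r) * (\<theta>\<^sup>2 / 2) + 1) (- ln \<eta> + l * \<bar>\<theta>\<bar> + (\<bar>ln l\<bar> + l + (1 + 1 / r) + 1 / 2))"
    by (rule spike_slab_coord_risk_le[OF l \<eta> r])
  moreover have "min ((1 + 1 / r) * (\<theta>\<^sup>2 / 2)) L - min (\<theta>\<^sup>2 / 2) L \<le> e * L"
  proof -
    have "1 - 1 / (1 + 1 / r) = e" using r by (simp add: e_def field_simps)
    then show ?thesis
      using min_scaled_diff_le[OF L, of "\<theta>\<^sup>2 / 2" "1 + 1 / r"] r by simp
  qed
  moreover have "(1 + l) * \<bar>\<theta>\<bar> \<le> e * L + 2 * l\<^sup>2 + 2 * (1 + l)\<^sup>2 * (1 + r)"
  proof -
    have "l * \<bar>\<theta>\<bar> \<le> \<theta>\<^sup>2 / 8 + 2 * l\<^sup>2"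
      using sum_squares_bound[of "2 * l" "\<bar>\<theta>\<bar> / 2"] by (simp add: power_divide power_mult_distrib)
    then have "\<theta>\<^sup>2 / 8 \<le> L + 2 * l\<^sup>2" using \<theta> by (simp add: L_def)
    then have 1: "e * (\<theta>\<^sup>2 / 8) \<le> e * (L + 2 * l\<^sup>2)" using e by (intro mult_left_mono) auto
    have 2: "e * (2 * l\<^sup>2) \<le> 2 * l\<^sup>2" using e by (intro mult_left_le_one_le) auto
    \<comment> \<open>Young's inequality with weight \<open>e\<close>, so that the quadratic part costs only
      \<open>e * L\<close> up to a constant.\<close>
    have "0 \<le> e / 8 * (\<bar>\<theta>\<bar> - 4 * (1 + l) * (1 + r))\<^sup>2" using e by simp
    also have "\<dots> = e * (\<theta>\<^sup>2 / 8) - (e * (1 + r)) * ((1 + l) * \<bar>\<theta>\<bar>) + (e * (1 + r)) * (2 * (1 + l)\<^sup>2 * (1 + r))"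
      by (simp add: power2_diff power_mult_distrib algebra_simps power2_eq_square)
    also have "e * (1 + r) = 1" using r by (simp add: e_def)
    finally show ?thesis using 1 2 by (simp add: distrib_left)
  qed
  moreover have "0 \<le> l * \<bar>\<theta>\<bar>" "0 \<le> \<bar>ln l\<bar> + l + (1 + 1 / r) + 1 / 2" using l r by simp_all
  ultimately have "coord_risk (spike_slab1 l \<eta>) r \<theta> \<le>
    ln 2 + \<bar>ln (l * sqrt pi)\<bar> + 4 * l\<^sup>2 + 3 + (\<bar>ln l\<bar> + l + (1 + 1 / r) + 1 / 2)
      + 2 * (1 + l)\<^sup>2 * (1 + r) + 2 * (e * L)"
    unfolding b_def L_def[symmetric] distrib_right one_power2 mult_1_left mult_1_right
    by (auto simp: min_def split: if_splits)
  then show ?thesis by (simp add: e_def L_def)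
qed

text \<open>The constant depends on neither the mixing weight nor the mean, which is what makes the bound
  usable as \<open>n\<close> grows and \<open>\<eta>\<close> tends to zero.\<close>

lemma spike_slab_coord_risk_bound:
  assumes l: "0 < l" and r: "0 < r"
  obtains K where "0 \<le> K"
    "\<And>\<eta> \<theta>. 0 < \<eta> \<Longrightarrow> \<eta> \<le> 1 / 2 \<Longrightarrow>
      coord_risk (spike_slab1 l \<eta>) r \<theta> \<le> K + 2 / (1 + r) * ln (1 / \<eta>)"
proof
  let ?K = "ln 2 + \<bar>ln (l * sqrt pi)\<bar> + 4 * l\<^sup>2 + 4 + (\<bar>ln l\<bar> + l + (1 + 1 / r) + 1 / 2)
      + 2 * (1 + l)\<^sup>2 * (1 + r)"
  show "0 \<le> ?K" using l r by simp
  fix \<eta> \<theta> :: real assume \<eta>: "0 < \<eta>" "\<eta> \<le> 1 / 2"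
  have "0 \<le> - ln \<eta>" using \<eta> by simp
  then have nonneg: "0 \<le> 2 * (1 / (1 + r)) * (- ln \<eta>)" "0 \<le> 2 * (1 + l)\<^sup>2 * (1 + r)"
    using l r by (intro mult_nonneg_nonneg; simp)+
  have "coord_risk (spike_slab1 l \<eta>) r \<theta> \<le> ?K + 2 * (1 / (1 + r)) * (- ln \<eta>)"
  proof (cases "- ln \<eta> + l * \<bar>\<theta>\<bar> \<le> \<theta>\<^sup>2 / 4")
    case True
    show ?thesis
      using spike_slab_coord_risk_large[OF l \<eta> r True] nonneg zero_le_power2[of l] by linarith
  next
    case False
    then show ?thesis
      using spike_slab_coord_risk_moderate[OF l \<eta> r, of \<theta>] by linarith
  qed
  then show "coord_risk (spike_slab1 l \<eta>) r \<theta> \<le> ?K + 2 / (1 + r) * ln (1 / \<eta>)"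
    using \<eta> by (simp add: ln_div)
qed

section \<open>Sparse vectors\<close>

lemma spike_slab_pred_risk_le:
  assumes l: "0 < l" and r: "0 < r" and \<eta>: "0 < \<eta>" "\<eta> < 1"
    and K: "\<And>t. coord_risk (spike_slab1 l \<eta>) r t \<le> K" "0 \<le> K"
    and \<theta>: "\<theta> \<in> sparse_vectors n s"
  shows "pred_risk n r \<theta> (pred_density n r (spike_slab n l \<eta>))
    \<le> ereal (real s * K + real n * ln (1 / (1 - \<eta>)))"
proof -
  interpret spike_prior "spike_slab1 l \<eta>" using l \<eta> by (intro spike_prior_spike_slab1)
  let ?S = "{i \<in> {..<n}. \<theta> i \<noteq> 0}"
  have "coord_risk (spike_slab1 l \<eta>) r (\<theta> i) \<le> (if i \<in> ?S then K else 0) + ln (1 / (1 - \<eta>))"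
    if "i < n" for i
  proof -
    have "0 \<le> ln (1 / (1 - \<eta>))" using \<eta> by (intro ln_ge_zero) simp
    moreover have "coord_risk (spike_slab1 l \<eta>) r 0 \<le> ln (1 / (1 - \<eta>))"
      using coord_risk_zero_le[OF r] spike_prior_spike_slab1(2)[OF l \<eta>] \<eta> by (simp add: ln_div)
    ultimately show ?thesis
      using K(1)[of "\<theta> i"] that by auto
  qed
  then have "(\<Sum>i<n. coord_risk (spike_slab1 l \<eta>) r (\<theta> i))
      \<le> (\<Sum>i<n. (if i \<in> ?S then K else 0) + ln (1 / (1 - \<eta>)))"
    by (intro sum_mono) simp
  also have "\<dots> = real (card ?S) * K + real n * ln (1 / (1 - \<eta>))"
    by (simp add: sum.distrib sum.If_cases Int_def)
  also have "\<dots> \<le> real s * K + real n * ln (1 / (1 - \<eta>))"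
    using \<theta> K(2) by (intro add_right_mono mult_right_mono) (auto simp: sparse_vectors_def)
  finally show ?thesis
    unfolding spike_slab_def pred_risk_eq_sum[OF r] by simp
qed

lemma eventually_ln_inverse_sparsity_ge:
  fixes s :: "nat \<Rightarrow> nat"
  assumes "\<And>n. n \<ge> 1 \<Longrightarrow> 1 \<le> s n" and "(\<lambda>n. real (s n) / real n) \<longlonglongrightarrow> 0"
  shows "\<forall>\<^sub>F n in sequentially. B \<le> ln (real n / real (s n))"
proof -
  have "\<forall>\<^sub>F n in sequentially. real (s n) / real n < exp (- B)"
    using assms(2) by (rule order_tendstoD) simp
  then show ?thesis using eventually_ge_at_top[of 1]
  proof eventually_elim
    case (elim n)
    then have pos: "0 < real n" "0 < real (s n)" using assms(1)[of n] by auto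
    then have "ln (real (s n) / real n) \<le> ln (exp (- B))"
      using elim by (subst ln_le_cancel_iff) auto
    then show ?case using pos by (simp add: ln_div)
  qed
qed

text \<open>With odds \<open>s n / n\<close> for the slab, \<open>ln (1 / \<eta> n)\<close> is
  \<open>ln (n / s n)\<close> up to \<open>ln 2\<close>, and the zero coordinates together cost at most
  \<open>s n\<close>. Every error is thus a multiple of \<open>s n\<close>, and since
  \<open>ln (n / s n)\<close> tends to infinity, any leading constant above
  \<open>2 / (1 + r)\<close> eventually absorbs them together with an arbitrary real
  \<open>R\<close>.\<close>

lemma eventually_spike_slab_sup_risk_le:
  fixes r l a R :: real and s :: "nat \<Rightarrow> nat" and \<eta> :: "nat \<Rightarrow> real"
  assumes r: "0 < r" and l: "0 < l" and a: "2 / (1 + r) < a"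
    and s: "\<And>n. n \<ge> 1 \<Longrightarrow> 1 \<le> s n \<and> s n \<le> n"
    and eta: "\<And>n. n \<ge> 1 \<Longrightarrow> 0 < \<eta> n \<and> \<eta> n < 1 \<and> (1 - \<eta> n) / \<eta> n = real n / real (s n)"
    and sparse: "(\<lambda>n. real (s n) / real n) \<longlonglongrightarrow> 0"
  shows "\<forall>\<^sub>F n in sequentially.
    (SUP \<theta>\<in>sparse_vectors n (s n). pred_risk n r \<theta> (pred_density n r (spike_slab n l (\<eta> n))))
    \<le> ereal (a * real (s n) * ln (real n / real (s n)) + R)"
proof -
  obtain K where K: "0 \<le> K" "\<And>\<eta> \<theta>. 0 < \<eta> \<Longrightarrow> \<eta> \<le> 1 / 2 \<Longrightarrow>
      coord_risk (spike_slab1 l \<eta>) r \<theta> \<le> K + 2 / (1 + r) * ln (1 / \<eta>)"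
    using spike_slab_coord_risk_bound[OF l r] by blast
  define e where "e = 2 / (1 + r)"
  have e: "0 < e" "e < a" using r a by (auto simp: e_def)
  define B where "B = (K + e * ln 2 + 1 + \<bar>R\<bar>) / (a - e)"
  have "\<forall>\<^sub>F n in sequentially. B \<le> ln (real n / real (s n))"
    using s sparse by (intro eventually_ln_inverse_sparsity_ge) auto
  then show ?thesis using eventually_ge_at_top[of 1]
  proof eventually_elim
    case (elim n)
    define X where "X = ln (real n / real (s n))"
    have pos: "1 \<le> real (s n)" "real (s n) \<le> real n" using s[of n] elim by auto
    have \<eta>: "0 < \<eta> n" "\<eta> n < 1" and odds: "(1 - \<eta> n) / \<eta> n = real n / real (s n)"
      using eta[of n] elim by auto
    have ratio: "1 \<le> real n / real (s n)" using pos by simp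
    have inv: "1 / \<eta> n = 1 + real n / real (s n)"
      using odds \<eta> by (simp add: field_simps)
    have half: "\<eta> n \<le> 1 / 2"
      using ratio \<eta> unfolding odds[symmetric] by (simp add: field_simps)
    have ln_slab: "ln (1 / \<eta> n) \<le> ln 2 + X" "0 \<le> ln (1 / \<eta> n)"
    proof -
      have "ln (1 / \<eta> n) \<le> ln (2 * (real n / real (s n)))"
        unfolding inv using ratio by (subst ln_le_cancel_iff) auto
      also have "\<dots> = ln 2 + X" using pos by (simp add: X_def ln_mult ln_div)
      finally show "ln (1 / \<eta> n) \<le> ln 2 + X" .
      show "0 \<le> ln (1 / \<eta> n)" using \<eta> by (intro ln_ge_zero) simp
    qed
    have "1 / (1 - \<eta> n) = 1 + real (s n) / real n"
    proof -
      have "\<eta> n / (1 - \<eta> n) = real (s n) / real n" using arg_cong[OF odds, of inverse] by simp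
      then show ?thesis using \<eta> by (simp add: field_simps)
    qed
    then have "ln (1 / (1 - \<eta> n)) \<le> real (s n) / real n"
      using pos by (simp add: ln_add_one_self_le_self)
    then have ln_spike: "real n * ln (1 / (1 - \<eta> n)) \<le> real (s n)"
      using pos by (simp add: field_simps)
    define k where "k = K + 2 / (1 + r) * ln (1 / \<eta> n)"
    have k: "0 \<le> k" using K(1) ln_slab(2) r by (simp add: k_def)
    have "k \<le> K + e * (ln 2 + X)"
      using mult_left_mono[OF ln_slab(1), of e] e by (simp add: k_def e_def)
    then have "real (s n) * k \<le> real (s n) * (K + e * (ln 2 + X))"
      using pos by (intro mult_left_mono) auto
    moreover have "\<bar>R\<bar> \<le> real (s n) * ((a - e) * X - (K + e * ln 2 + 1))"
    proof -
      have "\<bar>R\<bar> \<le> (a - e) * X - (K + e * ln 2 + 1)"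
        using elim(1) e unfolding B_def X_def[symmetric] by (simp add: pos_divide_le_eq mult.commute)
      then show ?thesis
        using mult_mono[OF pos(1), of "\<bar>R\<bar>" "(a - e) * X - (K + e * ln 2 + 1)"] by linarith
    qed
    ultimately have bound: "real (s n) * k + real n * ln (1 / (1 - \<eta> n)) \<le> a * real (s n) * X + R"
      using ln_spike abs_ge_minus_self[of R] by (simp add: algebra_simps)
    show ?case
    proof (rule SUP_least)
      fix \<theta> assume "\<theta> \<in> sparse_vectors n (s n)"
      then have "pred_risk n r \<theta> (pred_density n r (spike_slab n l (\<eta> n)))
          \<le> ereal (real (s n) * k + real n * ln (1 / (1 - \<eta> n)))"
        using K(2) half \<eta> k l r unfolding k_def
        by (intro spike_slab_pred_risk_le) auto
      also have "\<dots> \<le> ereal (a * real (s n) * X + R)"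
        using bound by (simp only: ereal_less_eq)
      finally show "pred_risk n r \<theta> (pred_density n r (spike_slab n l (\<eta> n)))
          \<le> ereal (a * real (s n) * ln (real n / real (s n)) + R)"
        unfolding X_def .
    qed
  qed
qed

theorem theorem3:
  fixes r v lam C Cstar :: real and s :: "nat \<Rightarrow> nat" and \<eta> :: "nat \<Rightarrow> real"
  assumes r: "0 < r"
    and v: "v = 1 / (1 + 1 / r)"
    and s: "\<And>n. n \<ge> 1 \<Longrightarrow> 1 \<le> s n \<and> s n \<le> n"
    and eta: "\<And>n. n \<ge> 1 \<Longrightarrow> 0 < \<eta> n \<and> \<eta> n < 1 \<and> (1 - \<eta> n) / \<eta> n = real n / real (s n)"
    and lam_pos: "0 < lam"
    and lam_small: "r < 1 \<Longrightarrow> C > 2 / (v * (1/2 + 4)) \<and> lam\<^sup>2 = v * C"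
    and lam_large: "r \<ge> 1 \<Longrightarrow> Cstar > 2 / (5 * (1 - v)) \<and> lam\<^sup>2 = (1 - v) * Cstar"
    and sparse: "(\<lambda>n. real (s n) / real n) \<longlonglongrightarrow> 0"
  shows "\<forall>\<^sub>F n in sequentially.
    (SUP \<theta>\<in>sparse_vectors n (s n).
        pred_risk n r \<theta> (pred_density n r (spike_slab n lam (\<eta> n))))
    \<le> ereal (5 / (1 + r) * real (s n) * ln (real n / real (s n)) +
        (if r \<ge> 1
         then ln (8 * sqrt pi) + 10 + 2 * Cstar * (1 - v) + Cstar * sqrt (2 / pi)
              + ln (2 * sqrt (Cstar * (1 - v)) + Cstar * (1 - v))
         else ln (8 * sqrt (2 * pi)) + 9 + C / (r + 1) * (1/2 + 4) + sqrt C * sqrt (1 / (8 * pi))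
              + ln (2 * sqrt C + C)))"
  using r by (intro eventually_spike_slab_sup_risk_le[OF r lam_pos _ s eta sparse]) (simp add: divide_strict_right_mono)

end
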